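(* For every prime power $q$, there exists an $(r \times c, v)$-unordered triple array with $r = \frac{q^3 - 1}{q - 1}$, $c = \frac{q^4 - 1}{q - 1}$ and $v = \frac{(q^4 - 1)(q^3 - 1)}{(q^2 - 1)(q - 1)}$.
   Context: An $(r \times c, v)$-unordered triple array on a set $V$ of $v$ symbols is a collection of $c$-subsets $R_1, \dots, R_r \subseteq V$ (row-sets) and $r$-subsets $C_1, \dots, C_c \subseteq V$ (column-sets) such that, for some integers $e, \lambda_{rc}, \lambda_{rr}, \lambda_{cc}$, each symbol lies in exactly $e$ row-sets and exactly $e$ column-sets, $|R_i \cap C_j| = \lambda_{rc}$ for all $i,j$, $|R_i \cap R_s| = \lambda_{rr}$ for all $i \neq s$, and $|C_j \cap C_t| = \lambda_{cc}$ for all $j \neq t$. *)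

theory Defs
  imports "HOL-Number_Theory.Prime_Powers"
begin

text \<open>
  The row-sets and column-sets are indexed families \<open>R 1, \<dots>, R r\<close> and \<open>C 1, \<dots>, C c\<close>;
  values outside these index ranges are irrelevant. Since \<open>card\<close> of an infinite set is 0,
  finiteness of \<open>V\<close> is demanded explicitly. The parameters are natural numbers, as they
  are cardinalities.
\<close>

definition unordered_triple_array ::
  "nat \<Rightarrow> nat \<Rightarrow> nat \<Rightarrow> 'a set \<Rightarrow> (nat \<Rightarrow> 'a set) \<Rightarrow> (nat \<Rightarrow> 'a set) \<Rightarrow> bool" where
  "unordered_triple_array r c v V R C \<longleftrightarrow>
     finite V \<and> card V = v \<and>
     (\<forall>i\<in>{1..r}. R i \<subseteq> V \<and> card (R i) = c) \<and>
     (\<forall>j\<in>{1..c}. C j \<subseteq> V \<and> card (C j) = r) \<and>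
     (\<exists>e l_rc l_rr l_cc :: nat.
        (\<forall>x\<in>V. card {i\<in>{1..r}. x \<in> R i} = e \<and> card {j\<in>{1..c}. x \<in> C j} = e) \<and>
        (\<forall>i\<in>{1..r}. \<forall>j\<in>{1..c}. card (R i \<inter> C j) = l_rc) \<and>
        (\<forall>i\<in>{1..r}. \<forall>s\<in>{1..r}. i \<noteq> s \<longrightarrow> card (R i \<inter> R s) = l_rr) \<and>
        (\<forall>j\<in>{1..c}. \<forall>t\<in>{1..c}. j \<noteq> t \<longrightarrow> card (C j \<inter> C t) = l_cc))"

end

theory Submission
  imports Defs "HOL-Number_Theory.Residues" "HOL-Algebra.Algebraic_Closure"
begin

text \<open>
  The symbols are the lines of \<open>PG(3,q)\<close> and the column-sets are the pencils of lines through a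
  point. The lines are partitioned into \<open>q^2 + q + 1\<close> spreads, which are matched with the lines of a
  projective plane of order \<open>q\<close>; the row-set of a point of this plane is the union of the \<open>q + 1\<close>
  spreads matched with the plane lines through it. A row-set and a pencil then share one line for
  each of these \<open>q + 1\<close> spreads, and two row-sets share exactly one spread.

  For \<open>q > 2\<close> the spreads come from a regular spread and the \<open>q^2 + q\<close> images of a derived regular
  spread under a group fixing one line pointwise. Let \<open>K\<close> be the field with \<open>q^2\<close> elements,
  \<open>U\<close> its group of elements of norm 1, and \<open>F_w = {t. t^q = w t}\<close> for \<open>w \<in> U\<close>. Writing a point
  \<open>(x, y)\<close> of \<open>K^2\<close> with \<open>x \<noteq> 0\<close> as \<open>(u, z) = (x^q / x, y / x)\<close>, and a point \<open>(0, y)\<close> as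
  \<open>y^q / y\<close>, the points of \<open>PG(3,q)\<close> become \<open>U + U \<times> K\<close>. The derived spreads are indexed by the
  cosets \<open>B\<close> of the \<open>F_w\<close>, that is, by the lines of the affine plane \<open>K\<close>; the spread of \<open>(w, B)\<close>
  has the lines \<open>{u w} \<union> {u} \<times> B\<close> and \<open>{(u, s + f (\<alpha> + \<beta> u w)). u \<in> U}\<close> with \<open>0 \<noteq> f \<in> F_w\<close>,
  \<open>s \<in> B\<close>. This works once \<open>\<alpha> + \<beta> u\<close> never lies in the field with \<open>q\<close> elements, which is
  possible exactly for \<open>q > 2\<close>; for \<open>q = 2\<close> a cyclic Kirkman system on 15 points is used.

  Throughout it suffices to show that two points lie on at most one line: the parameters make
  the corresponding counts tight.
\<close>

section \<open>Resolvable linear spaces\<close>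

lemma card_off_diagonal:
  assumes "finite A"
  shows "card {(x, y). x \<in> A \<and> y \<in> A \<and> x \<noteq> y} = card A * (card A - 1)"
proof -
  have "{(x, y). x \<in> A \<and> y \<in> A \<and> x \<noteq> y} = Sigma A (\<lambda>x. A - {x})" by auto
  then show ?thesis using assms by (simp add: card_SigmaI)
qed

text \<open>\<open>full\<close> equates the number of ordered pairs of distinct points inside blocks
  with the number of all such pairs, so that at most one block per pair becomes exactly one.\<close>

locale full_linear_space =
  fixes S :: "'a set" and J :: "'i set" and blk :: "'i \<Rightarrow> 'a set" and m :: nat
  assumes finite_S: "finite S" and finite_J: "finite J"
    and blk_subset: "j \<in> J \<Longrightarrow> blk j \<subseteq> S"
    and card_blk: "j \<in> J \<Longrightarrow> card (blk j) = m"
    and at_most_one: "\<lbrakk>j \<in> J; j' \<in> J; x \<noteq> y; x \<in> blk j; y \<in> blk j; x \<in> blk j'; y \<in> blk j'\<rbrakk> \<Longrightarrow> j = j'"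
    and full: "card J * (m * (m - 1)) = card S * (card S - 1)"
begin

lemma finite_blk: "j \<in> J \<Longrightarrow> finite (blk j)"
  using blk_subset finite_S finite_subset by blast

text \<open>Count the triples of a block and an ordered pair in it: forgetting the block is
  injective by \<open>at_most_one\<close>, hence onto all pairs by \<open>full\<close>.\<close>

lemma block_through:
  assumes "x \<in> S" "y \<in> S" "x \<noteq> y"
  obtains j where "j \<in> J" "x \<in> blk j" "y \<in> blk j"
proof -
  let ?D = "\<lambda>A. {(x, y). x \<in> A \<and> y \<in> A \<and> x \<noteq> y}"
  let ?S = "Sigma J (\<lambda>j. ?D (blk j))"
  have fin: "finite (?D A)" if "finite A" for A :: "'a set"
    by (rule finite_subset[of _ "A \<times> A"]) (use that in auto)
  have "card ?S = (\<Sum>j\<in>J. card (?D (blk j)))"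
    using finite_J finite_blk fin by (intro card_SigmaI) auto
  also have "\<dots> = (\<Sum>j\<in>J. m * (m - 1))"
    using card_off_diagonal finite_blk card_blk by (intro sum.cong) auto
  also have "\<dots> = card (?D S)"
    using full card_off_diagonal[OF finite_S] by simp
  finally have "card ?S = card (?D S)" .
  moreover have "inj_on snd ?S"
    using at_most_one by (auto simp: inj_on_def)
  ultimately have "card (snd ` ?S) = card (?D S)"
    by (simp add: card_image)
  moreover have "snd ` ?S \<subseteq> ?D S" using blk_subset by force
  ultimately have "snd ` ?S = ?D S" using fin[OF finite_S] card_subset_eq by blast
  then have "(x, y) \<in> snd ` ?S" using assms by auto
  then show ?thesis using that by auto
qed

lemma card_blocks_through_pair:
  assumes "x \<in> S" "y \<in> S" "x \<noteq> y"
  shows "card {j \<in> J. x \<in> blk j \<and> y \<in> blk j} = 1"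
proof -
  obtain j where "j \<in> J" "x \<in> blk j" "y \<in> blk j" using block_through[OF assms] .
  then have "{j \<in> J. x \<in> blk j \<and> y \<in> blk j} = {j}" using at_most_one assms(3) by auto
  then show ?thesis by simp
qed

text \<open>The blocks through \<open>x\<close>, with \<open>x\<close> removed, partition the other
  points.\<close>

lemma card_blocks_through_point:
  assumes "x \<in> S"
  shows "card {j \<in> J. x \<in> blk j} * (m - 1) = card S - 1"
proof -
  let ?J = "{j \<in> J. x \<in> blk j}"
  have "S - {x} = (\<Union>j\<in>?J. blk j - {x})"
  proof (intro equalityI subsetI)
    fix y assume "y \<in> S - {x}"
    then obtain j where "j \<in> J" "x \<in> blk j" "y \<in> blk j"
      using block_through[of x y] assms by blast
    then show "y \<in> (\<Union>j\<in>?J. blk j - {x})" using \<open>y \<in> S - {x}\<close> by blast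
  qed (use blk_subset in blast)
  also have "card \<dots> = (\<Sum>j\<in>?J. card (blk j - {x}))"
  proof (rule card_UN_disjoint)
    show "\<forall>j\<in>?J. \<forall>j'\<in>?J. j \<noteq> j' \<longrightarrow> (blk j - {x}) \<inter> (blk j' - {x}) = {}"
      using at_most_one by blast
  qed (use finite_J finite_blk in auto)
  also have "\<dots> = (\<Sum>j\<in>?J. m - 1)"
    using card_blk finite_blk by (intro sum.cong) (auto simp: card_Diff_singleton)
  finally show ?thesis using assms finite_S by simp
qed

end

section \<open>Transport of indices and symbols to natural numbers\<close>

lemma card_Collect_bij_betw:
  assumes "bij_betw f A B"
  shows "card {x \<in> A. Q (f x)} = card {y \<in> B. Q y}"
proof (rule bij_betw_same_card[of f], rule bij_betw_imageI)
  show "inj_on f {x \<in> A. Q (f x)}"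
    by (rule inj_on_subset[OF bij_betw_imp_inj_on[OF assms]]) blast
  show "f ` {x \<in> A. Q (f x)} = {y \<in> B. Q y}"
    using bij_betw_imp_surj_on[OF assms] by blast
qed

text \<open>The definition fixes the index ranges \<open>{1..r}\<close> and \<open>{1..c}\<close>;
  this lets a construction use index and symbol types of its own. Numberings of \<open>I\<close> and
  \<open>J\<close> and an injection of \<open>V\<close> carry all cardinalities over.\<close>

lemma unordered_triple_array_on_nat:
  fixes V :: "'s set" and R :: "'i \<Rightarrow> 's set" and C :: "'j \<Rightarrow> 's set"
  assumes fin: "finite V" "finite I" "finite J"
    and R: "\<And>i. i \<in> I \<Longrightarrow> R i \<subseteq> V" "\<And>i. i \<in> I \<Longrightarrow> card (R i) = card J"
    and C: "\<And>j. j \<in> J \<Longrightarrow> C j \<subseteq> V" "\<And>j. j \<in> J \<Longrightarrow> card (C j) = card I"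
    and e: "\<And>x. x \<in> V \<Longrightarrow> card {i \<in> I. x \<in> R i} = e"
      "\<And>x. x \<in> V \<Longrightarrow> card {j \<in> J. x \<in> C j} = e"
    and rc: "\<And>i j. i \<in> I \<Longrightarrow> j \<in> J \<Longrightarrow> card (R i \<inter> C j) = l_rc"
    and rr: "\<And>i s. i \<in> I \<Longrightarrow> s \<in> I \<Longrightarrow> i \<noteq> s \<Longrightarrow> card (R i \<inter> R s) = l_rr"
    and cc: "\<And>j t. j \<in> J \<Longrightarrow> t \<in> J \<Longrightarrow> j \<noteq> t \<Longrightarrow> card (C j \<inter> C t) = l_cc"
  shows "\<exists>(V' :: nat set) R' C'. unordered_triple_array (card I) (card J) (card V) V' R' C'"
proof -
  obtain \<rho> where \<rho>: "bij_betw \<rho> {1..card I} I"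
    using ex_bij_betw_nat_finite_1[OF fin(2)] by blast
  obtain \<gamma> where \<gamma>: "bij_betw \<gamma> {1..card J} J"
    using ex_bij_betw_nat_finite_1[OF fin(3)] by blast
  obtain \<nu> :: "'s \<Rightarrow> nat" where \<nu>: "inj_on \<nu> V"
    using finite_imp_inj_to_nat_seg[OF fin(1)] by blast
  have \<rho>I: "\<rho> i \<in> I" if "i \<in> {1..card I}" for i using \<rho> that bij_betwE by blast
  have \<gamma>J: "\<gamma> j \<in> J" if "j \<in> {1..card J}" for j using \<gamma> that bij_betwE by blast
  have \<rho>_inj: "\<rho> i \<noteq> \<rho> s" if "i \<in> {1..card I}" "s \<in> {1..card I}" "i \<noteq> s" for i s
    using inj_on_contraD[OF bij_betw_imp_inj_on[OF \<rho>]] that by blast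
  have \<gamma>_inj: "\<gamma> i \<noteq> \<gamma> s" if "i \<in> {1..card J}" "s \<in> {1..card J}" "i \<noteq> s" for i s
    using inj_on_contraD[OF bij_betw_imp_inj_on[OF \<gamma>]] that by blast
  have img: "card (\<nu> ` A) = card A" if "A \<subseteq> V" for A
    using \<nu> that by (meson card_image inj_on_subset)
  have int: "card (\<nu> ` A \<inter> \<nu> ` B) = card (A \<inter> B)" if "A \<subseteq> V" "B \<subseteq> V" for A B
    using img[of "A \<inter> B"] inj_on_image_Int[OF \<nu> that] that by auto
  have mem: "\<nu> x \<in> \<nu> ` A \<longleftrightarrow> x \<in> A" if "A \<subseteq> V" "x \<in> V" for A x
    using \<nu> that by (meson inj_on_image_mem_iff)
  have eR: "card {i \<in> {1..card I}. \<nu> x \<in> \<nu> ` R (\<rho> i)} = e" if "x \<in> V" for x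
  proof -
    have "{i \<in> {1..card I}. \<nu> x \<in> \<nu> ` R (\<rho> i)} = {i \<in> {1..card I}. x \<in> R (\<rho> i)}"
      using mem[OF R(1)[OF \<rho>I] that] by auto
    then show ?thesis using card_Collect_bij_betw[OF \<rho>, of "\<lambda>i. x \<in> R i"] e(1)[OF that] by simp
  qed
  have eC: "card {j \<in> {1..card J}. \<nu> x \<in> \<nu> ` C (\<gamma> j)} = e" if "x \<in> V" for x
  proof -
    have "{j \<in> {1..card J}. \<nu> x \<in> \<nu> ` C (\<gamma> j)} = {j \<in> {1..card J}. x \<in> C (\<gamma> j)}"
      using mem[OF C(1)[OF \<gamma>J] that] by auto
    then show ?thesis using card_Collect_bij_betw[OF \<gamma>, of "\<lambda>j. x \<in> C j"] e(2)[OF that] by simp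
  qed
  have "unordered_triple_array (card I) (card J) (card V) (\<nu> ` V)
      (\<lambda>i. \<nu> ` R (\<rho> i)) (\<lambda>j. \<nu> ` C (\<gamma> j))"
    unfolding unordered_triple_array_def
  proof (intro conjI ballI, goal_cases)
    \<comment> \<open>Goal 7 is the existential over the four constants; the other six are
      finiteness, inclusions and sizes.\<close>
    case 7
    show ?case
    proof (rule exI[of _ e], rule exI[of _ l_rc], rule exI[of _ l_rr], rule exI[of _ l_cc],
        intro conjI ballI impI)
      fix i j assume i: "i \<in> {1..card I}" and j: "j \<in> {1..card J}"
      show "card (\<nu> ` R (\<rho> i) \<inter> \<nu> ` C (\<gamma> j)) = l_rc"
        using R(1)[OF \<rho>I[OF i]] C(1)[OF \<gamma>J[OF j]] int rc[OF \<rho>I[OF i] \<gamma>J[OF j]] by simp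
    next
      fix i s assume i: "i \<in> {1..card I}" and s: "s \<in> {1..card I}" "i \<noteq> s"
      show "card (\<nu> ` R (\<rho> i) \<inter> \<nu> ` R (\<rho> s)) = l_rr"
        using R(1)[OF \<rho>I[OF i]] R(1)[OF \<rho>I[OF s(1)]] int
          rr[OF \<rho>I[OF i] \<rho>I[OF s(1)] \<rho>_inj[OF i s]] by simp
    next
      fix j t assume j: "j \<in> {1..card J}" and t: "t \<in> {1..card J}" "j \<noteq> t"
      show "card (\<nu> ` C (\<gamma> j) \<inter> \<nu> ` C (\<gamma> t)) = l_cc"
        using C(1)[OF \<gamma>J[OF j]] C(1)[OF \<gamma>J[OF t(1)]] int
          cc[OF \<gamma>J[OF j] \<gamma>J[OF t(1)] \<gamma>_inj[OF j t]] by simp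
    next
      fix x assume "x \<in> \<nu> ` V"
      then obtain x' where x': "x' \<in> V" "x = \<nu> x'" by blast
      show "card {i \<in> {1..card I}. x \<in> \<nu> ` R (\<rho> i)} = e" using eR x' by simp
      show "card {j \<in> {1..card J}. x \<in> \<nu> ` C (\<gamma> j)} = e" using eC x' by simp
    qed
  next
    case (3 i) then show ?case using R(1)[OF \<rho>I] by blast
  next
    case (5 j) then show ?case using C(1)[OF \<gamma>J] by blast
  qed (use fin(1) img R[OF \<rho>I] C[OF \<gamma>J] in auto)
  then show ?thesis by blast
qed

text \<open>\<open>N\<close> indexes both the parallel classes of blocks on \<open>P\<close> and the
  lines of a plane with point set \<open>I\<close>; \<open>T k\<close> is the plane line matched
  with class \<open>k\<close>. That each class covers \<open>P\<close> and that any two points are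
  joined follows from the counts.\<close>

locale plane_indexed_resolution =
  fixes q :: nat and P :: "'p set" and N :: "'k set" and \<Lambda> :: "'k \<Rightarrow> 'l set"
    and blk :: "'k \<Rightarrow> 'l \<Rightarrow> 'p set" and I :: "'i set" and T :: "'k \<Rightarrow> 'i set"
  assumes q_pos: "0 < q"
    and finite_P: "finite P" and card_P: "card P = (q + 1) * (q\<^sup>2 + 1)"
    and finite_N: "finite N" and card_N: "card N = q\<^sup>2 + q + 1"
    and finite_I: "finite I" and card_I: "card I = q\<^sup>2 + q + 1"
    and card_\<Lambda>: "k \<in> N \<Longrightarrow> card (\<Lambda> k) = q\<^sup>2 + 1"
    and blk_subset: "\<lbrakk>k \<in> N; l \<in> \<Lambda> k\<rbrakk> \<Longrightarrow> blk k l \<subseteq> P"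
    and card_blk: "\<lbrakk>k \<in> N; l \<in> \<Lambda> k\<rbrakk> \<Longrightarrow> card (blk k l) = q + 1"
    and blk_disjoint: "\<lbrakk>k \<in> N; l \<in> \<Lambda> k; l' \<in> \<Lambda> k; x \<in> blk k l; x \<in> blk k l'\<rbrakk> \<Longrightarrow> l = l'"
    and blk_inter: "\<lbrakk>k \<in> N; k' \<in> N; l \<in> \<Lambda> k; l' \<in> \<Lambda> k'; x \<noteq> y;
      x \<in> blk k l; y \<in> blk k l; x \<in> blk k' l'; y \<in> blk k' l'\<rbrakk> \<Longrightarrow> k = k'"
    and T_subset: "k \<in> N \<Longrightarrow> T k \<subseteq> I"
    and card_T: "k \<in> N \<Longrightarrow> card (T k) = q + 1"
    and T_inter: "\<lbrakk>k \<in> N; k' \<in> N; i \<noteq> s; i \<in> T k; s \<in> T k; i \<in> T k'; s \<in> T k'\<rbrakk> \<Longrightarrow> k = k'"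
begin

lemma finite_\<Lambda>: "k \<in> N \<Longrightarrow> finite (\<Lambda> k)"
  using card_\<Lambda> by (metis add_is_0 card.infinite zero_neq_one)

lemma card_Sigma_\<Lambda>: "N' \<subseteq> N \<Longrightarrow> card (Sigma N' \<Lambda>) = card N' * (q\<^sup>2 + 1)"
proof -
  assume "N' \<subseteq> N"
  then have "card (Sigma N' \<Lambda>) = (\<Sum>k\<in>N'. card (\<Lambda> k))"
    using finite_N finite_\<Lambda> by (intro card_SigmaI) (auto intro: finite_subset)
  also have "\<dots> = (\<Sum>k\<in>N'. q\<^sup>2 + 1)"
    using card_\<Lambda> \<open>N' \<subseteq> N\<close> by (intro sum.cong) auto
  finally show ?thesis by simp
qed

sublocale plane: full_linear_space I N T "q + 1"
  using finite_I finite_N T_subset card_T T_inter card_N card_I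
  by unfold_locales (auto simp: algebra_simps power2_eq_square)

sublocale lines: full_linear_space P "Sigma N \<Lambda>" "\<lambda>(k, l). blk k l" "q + 1"
proof
  show "finite (Sigma N \<Lambda>)" using finite_N finite_\<Lambda> by blast
  have "card P - 1 = q * (q\<^sup>2 + q + 1)" by (simp add: card_P algebra_simps power2_eq_square)
  then show "card (Sigma N \<Lambda>) * ((q + 1) * (q + 1 - 1)) = card P * (card P - 1)"
    using card_Sigma_\<Lambda>[OF order_refl] by (simp add: card_P card_N algebra_simps)
  fix j j' x y
  assume *: "j \<in> Sigma N \<Lambda>" "j' \<in> Sigma N \<Lambda>" "x \<noteq> y"
    "x \<in> (case j of (k, l) \<Rightarrow> blk k l)" "y \<in> (case j of (k, l) \<Rightarrow> blk k l)"
    "x \<in> (case j' of (k, l) \<Rightarrow> blk k l)" "y \<in> (case j' of (k, l) \<Rightarrow> blk k l)"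
  then have "fst j = fst j'" using blk_inter by auto
  then show "j = j'" using * blk_disjoint by auto
qed (use finite_P blk_subset card_blk in auto)

lemma card_nodes_of_row:
  assumes "i \<in> I" shows "card {k \<in> N. i \<in> T k} = q + 1"
proof -
  have "card {k \<in> N. i \<in> T k} * q = (q + 1) * q"
    using plane.card_blocks_through_point[OF assms] by (simp add: card_I power2_eq_square)
  then show ?thesis using q_pos by (simp only: mult_cancel2) simp
qed

text \<open>In total \<open>x\<close> lies on as many blocks as there are classes, and on at most
  one block of each class, hence on exactly one of each.\<close>

lemma unique_block:
  assumes "x \<in> P" "k \<in> N"
  shows "\<exists>!l. l \<in> \<Lambda> k \<and> x \<in> blk k l"
proof -
  let ?S = "{j \<in> Sigma N \<Lambda>. x \<in> (case j of (k, l) \<Rightarrow> blk k l)}"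
  have "card ?S * q = card P - 1"
    using lines.card_blocks_through_point[OF assms(1)] by simp
  also have "\<dots> = card N * q" by (simp add: card_P card_N algebra_simps power2_eq_square)
  finally have "card ?S = card N" using q_pos by simp
  moreover have "inj_on fst ?S" using blk_disjoint by (auto simp: inj_on_def)
  ultimately have "card (fst ` ?S) = card N" by (simp add: card_image)
  moreover have "fst ` ?S \<subseteq> N" by auto
  ultimately have "fst ` ?S = N" using finite_N card_subset_eq by blast
  then have "k \<in> fst ` ?S" using assms(2) by simp
  then show ?thesis using blk_disjoint[OF assms(2)] by auto
qed

lemma card_blocks_at:
  assumes "x \<in> P" "N' \<subseteq> N"
  shows "card {(k, l) \<in> Sigma N' \<Lambda>. x \<in> blk k l} = card N'"
proof (rule bij_betw_same_card[of fst])
  have "k \<in> fst ` {(k, l) \<in> Sigma N' \<Lambda>. x \<in> blk k l}" if "k \<in> N'" for k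
    using unique_block[OF assms(1), of k] assms(2) that by force
  then show "bij_betw fst {(k, l) \<in> Sigma N' \<Lambda>. x \<in> blk k l} N'"
    using blk_disjoint assms(2) by (auto simp: bij_betw_def inj_on_def subset_iff)
qed

theorem unordered_triple_array:
  "\<exists>(V :: nat set) R C. unordered_triple_array (q\<^sup>2 + q + 1) ((q + 1) * (q\<^sup>2 + 1))
     ((q\<^sup>2 + q + 1) * (q\<^sup>2 + 1)) V R C"
proof -
  let ?V = "Sigma N \<Lambda>"
  let ?R = "\<lambda>i. Sigma {k \<in> N. i \<in> T k} \<Lambda>"
  let ?C = "\<lambda>x. {(k, l) \<in> ?V. x \<in> blk k l}"
  have "\<exists>(V :: nat set) R C. unordered_triple_array (card I) (card P) (card ?V) V R C"
  \<comment> \<open>\<open>e = q + 1\<close> is the size both of a plane line and of a block.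
    \<open>l_rc = q + 1\<close> counts the classes in a row, \<open>l_rr\<close> is the size of the
    one common class, and \<open>l_cc = 1\<close> is the block joining two points.\<close>
  proof (rule unordered_triple_array_on_nat[of ?V I P ?R ?C "q + 1" "q + 1" "q\<^sup>2 + 1" 1])
    show "finite ?V" using lines.finite_J .
    show "finite I" "finite P" using finite_I finite_P .
    show "?R i \<subseteq> ?V" for i by auto
    show "card (?R i) = card P" if "i \<in> I" for i
      using card_Sigma_\<Lambda>[of "{k \<in> N. i \<in> T k}"] card_nodes_of_row[OF that] card_P by simp
    show "?C x \<subseteq> ?V" for x by auto
    show "card (?C x) = card I" if "x \<in> P" for x
      using card_blocks_at[OF that order_refl] card_N card_I by simp
  next
    fix kl assume "kl \<in> ?V"
    then obtain k l where kl: "kl = (k, l)" "k \<in> N" "l \<in> \<Lambda> k" by auto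
    have "{i \<in> I. kl \<in> ?R i} = T k" using kl T_subset by auto
    then show "card {i \<in> I. kl \<in> ?R i} = q + 1" using card_T kl by simp
    have "{x \<in> P. kl \<in> ?C x} = blk k l" using kl blk_subset by auto
    then show "card {x \<in> P. kl \<in> ?C x} = q + 1" using card_blk kl by simp
  next
    fix i x assume "i \<in> I" "x \<in> P"
    have "?R i \<inter> ?C x = {(k, l) \<in> ?R i. x \<in> blk k l}" by auto
    then show "card (?R i \<inter> ?C x) = q + 1"
      using card_blocks_at[OF \<open>x \<in> P\<close>, of "{k \<in> N. i \<in> T k}"] card_nodes_of_row[OF \<open>i \<in> I\<close>] by simp
  next
    fix i s assume pr: "i \<in> I" "s \<in> I" "i \<noteq> s"
    have "?R i \<inter> ?R s = Sigma {k \<in> N. i \<in> T k \<and> s \<in> T k} \<Lambda>" by auto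
    then show "card (?R i \<inter> ?R s) = q\<^sup>2 + 1"
      using card_Sigma_\<Lambda>[of "{k \<in> N. i \<in> T k \<and> s \<in> T k}"] plane.card_blocks_through_pair[OF pr] by simp
  next
    fix x y assume xy: "x \<in> P" "y \<in> P" "x \<noteq> y"
    have "?C x \<inter> ?C y = {j \<in> ?V. x \<in> (case j of (k, l) \<Rightarrow> blk k l) \<and> y \<in> (case j of (k, l) \<Rightarrow> blk k l)}"
      by auto
    then show "card (?C x \<inter> ?C y) = 1" using lines.card_blocks_through_pair[OF xy] by simp
  qed
  then show ?thesis by (simp only: card_I card_P card_Sigma_\<Lambda>[OF order_refl] card_N)
qed

end

section \<open>Finite fields\<close>

lemma (in cring) binomial_expansion:
  assumes [simp]: "x \<in> carrier R" "y \<in> carrier R"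
  shows "(x \<oplus> y) [^] n = (\<Oplus>k\<in>{..n}. [(n choose k)] \<cdot> (x [^] k \<otimes> y [^] (n - k)))"
proof (induction n)
  case 0
  show ?case by simp
next
  case (Suc n)
  let ?t = "\<lambda>k. x [^] k \<otimes> y [^] (n - k)"
  let ?u = "\<lambda>k. x [^] Suc k \<otimes> y [^] (n - k)"
  let ?v = "\<lambda>k. x [^] k \<otimes> y [^] (Suc n - k)"
  have x: "(\<Oplus>k\<in>{..n}. [(n choose k)] \<cdot> ?t k) \<otimes> x = (\<Oplus>k\<in>{..n}. [(n choose k)] \<cdot> ?u k)"
    by (subst finsum_ldistr) (auto intro!: finsum_cong' simp: add_pow_ldistr add_pow_rdistr m_ac)
  have y: "(\<Oplus>k\<in>{..n}. [(n choose k)] \<cdot> ?t k) \<otimes> y = (\<Oplus>k\<in>{..n}. [(n choose k)] \<cdot> ?v k)"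
    by (subst finsum_ldistr) (auto intro!: finsum_cong' simp: add_pow_ldistr add_pow_rdistr m_ac Suc_diff_le)
  \<comment> \<open>Split off the term at 0, shift the index, and apply Pascal's rule to the
    rest.\<close>
  have "(\<Oplus>k\<in>{..Suc n}. [(Suc n choose k)] \<cdot> ?v k)
      = (\<Oplus>k\<in>{..n}. [(n choose k)] \<cdot> ?u k \<oplus> [(n choose Suc k)] \<cdot> ?u k) \<oplus> y [^] Suc n"
    by (subst finsum_Suc2) (auto intro!: arg_cong2[where f = "(\<oplus>)"] finsum_cong' simp: add.nat_pow_mult)
  also have "\<dots> = (\<Oplus>k\<in>{..n}. [(n choose k)] \<cdot> ?u k) \<oplus>
      ((\<Oplus>k\<in>{..n}. [(n choose Suc k)] \<cdot> ?u k) \<oplus> y [^] Suc n)"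
    by (subst finsum_addf) (auto simp: a_assoc)
  also have "(\<Oplus>k\<in>{..n}. [(n choose Suc k)] \<cdot> ?u k) \<oplus> y [^] Suc n
      = (\<Oplus>k\<in>{..Suc n}. [(n choose k)] \<cdot> ?v k)"
    by (subst finsum_Suc2) auto
  \<comment> \<open>The top term drops out because \<open>n choose Suc n\<close> is 0.\<close>
  also have "\<dots> = (\<Oplus>k\<in>{..n}. [(n choose k)] \<cdot> ?v k)"
    by (subst finsum_Suc) (auto simp: binomial_eq_0)
  finally show ?case
    using Suc.IH x y by (simp add: r_distr)
qed

text \<open>The equation \<open>[p] \<cdot> \<one> = \<zero>\<close> expresses characteristic
  \<open>p\<close> from here on.\<close>

lemma (in cring) add_pow_eq_zero_if_dvd:
  assumes "[p] \<cdot> \<one> = \<zero>" "p dvd n" "x \<in> carrier R"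
  shows "[(n::nat)] \<cdot> x = \<zero>"
proof -
  obtain m where "n = p * m" using assms(2) by blast
  then have "[n] \<cdot> \<one> = \<zero>"
    using add.nat_pow_pow[of "\<one>" m p] assms(1) by simp
  then show ?thesis
    using add_pow_ldistr[of "\<one>" x n] assms(3) by simp
qed

text \<open>The binomial coefficients strictly between the ends are divisible by \<open>p\<close>,
  so only the two extreme terms survive.\<close>

lemma (in cring) prime_char_pow_add:
  assumes p: "Factorial_Ring.prime p" "[p] \<cdot> \<one> = \<zero>"
    and xy[simp]: "x \<in> carrier R" "y \<in> carrier R"
  shows "(x \<oplus> y) [^] p = x [^] p \<oplus> y [^] (p::nat)"
proof -
  let ?f = "\<lambda>k. [(p choose k)] \<cdot> (x [^] k \<otimes> y [^] (p - k))"
  have "p > 0" using p(1) prime_gt_0_nat by blast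
  have "{..p} = insert 0 (insert p {1..<p})" by auto
  then have "(x \<oplus> y) [^] p = ?f 0 \<oplus> (?f p \<oplus> (\<Oplus>k\<in>{1..<p}. ?f k))"
    using \<open>p > 0\<close> by (simp add: binomial_expansion)
  also have "(\<Oplus>k\<in>{1..<p}. ?f k) = (\<Oplus>k\<in>{1..<p}. \<zero>)"
  proof (rule finsum_cong')
    fix k assume "k \<in> {1..<p}"
    then have "p dvd (p choose k)"
      using p(1) by (intro dvd_choose_prime) auto
    then show "?f k = \<zero>"
      using add_pow_eq_zero_if_dvd[OF p(2)] by simp
  qed auto
  finally show ?thesis by (simp add: a_comm)
qed

lemma (in cring) prime_power_char_pow_add:
  assumes p: "Factorial_Ring.prime p" "[p] \<cdot> \<one> = \<zero>"
    and [simp]: "x \<in> carrier R" "y \<in> carrier R"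
  shows "(x \<oplus> y) [^] (p ^ m) = x [^] (p ^ m) \<oplus> y [^] (p ^ m :: nat)"
proof (induction m)
  case (Suc m)
  have "z [^] (p ^ Suc m) = (z [^] (p ^ m)) [^] p" if "z \<in> carrier R" for z
    using that by (simp add: nat_pow_pow mult.commute)
  then show ?case using Suc prime_char_pow_add[OF p] by simp
qed simp

text \<open>Additivity applied to \<open>\<ominus> x \<oplus> x\<close> avoids a case split on the
  parity of \<open>p\<close>.\<close>

lemma (in cring) prime_power_char_pow_minus:
  assumes p: "Factorial_Ring.prime p" "[p] \<cdot> \<one> = \<zero>" and x[simp]: "x \<in> carrier R"
  shows "(\<ominus> x) [^] (p ^ m) = \<ominus> (x [^] (p ^ m :: nat))"
proof -
  have "p ^ m > 0" using p(1) prime_gt_0_nat by simp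
  then have "\<zero> [^] (p ^ m) = \<zero>" by (simp add: nat_pow_zero)
  then have "(\<ominus> x) [^] (p ^ m) \<oplus> x [^] (p ^ m) = \<zero>"
    using prime_power_char_pow_add[OF p, of "\<ominus> x" x m] by (simp add: l_neg)
  then show ?thesis by (simp add: minus_equality)
qed

lemma (in ring_hom_ring) hom_add_pow:
  "x \<in> carrier R \<Longrightarrow> h ([(n::nat)] \<cdot>\<^bsub>R\<^esub> x) = [n] \<cdot>\<^bsub>S\<^esub> h x"
  by (induction n) simp_all


section \<open>The polynomial \<open>X^n - X\<close> and the finite field formed by its
  roots\<close>

lemma (in cring) minus_add_cancel_right:
  "\<lbrakk>x \<in> carrier R; y \<in> carrier R; z \<in> carrier R\<rbrakk> \<Longrightarrow> (x \<oplus> z) \<ominus> (y \<oplus> z) = x \<ominus> y"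
  by algebra

lemma (in cring) mult_minus_one_right:
  "\<lbrakk>x \<in> carrier R; y \<in> carrier R\<rbrakk> \<Longrightarrow> x \<otimes> (y \<ominus> \<one>) = x \<otimes> y \<ominus> x"
  by algebra

lemma (in domain) eval_var_pow_minus_var:
  assumes "x \<in> carrier R"
  shows "eval (X [^]\<^bsub>poly_ring R\<^esub> (n::nat) \<ominus>\<^bsub>poly_ring R\<^esub> X) x = x [^] n \<ominus> x"
proof -
  interpret E: ring_hom_cring "poly_ring R" R "\<lambda>p. eval p x"
    using eval_cring_hom[OF carrier_is_subring assms] .
  have "X \<in> carrier (poly_ring R)"
    using var_closed(1)[OF carrier_is_subring] .
  then show ?thesis
    using eval_var[OF assms] by (simp add: a_minus_def)
qed

lemma (in field) degree_var_pow_minus_var: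
  assumes "n > 1"
  shows "degree (X [^]\<^bsub>poly_ring R\<^esub> (n::nat) \<ominus>\<^bsub>poly_ring R\<^esub> X) = n"
proof -
  interpret UP: domain "poly_ring R"
    using univ_poly_is_domain[OF carrier_is_subring] .
  have X: "X \<in> carrier (poly_ring R)" "degree X = 1"
    using var_closed(1)[OF carrier_is_subring] by (auto simp: var_def)
  have dX: "degree (\<ominus>\<^bsub>poly_ring R\<^esub> X) = 1"
    using univ_poly_a_inv_degree[OF carrier_is_subring X(1)] X(2) by simp
  have dXn: "degree (X [^]\<^bsub>poly_ring R\<^esub> n) = n"
    using polynomial_pow_degree[OF X(1)] X(2) by simp
  show ?thesis
    unfolding a_minus_def univ_poly_add
    using poly_add_degree_eq[OF carrier_is_subring, of "X [^]\<^bsub>poly_ring R\<^esub> n" "\<ominus>\<^bsub>poly_ring R\<^esub> X"]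
      dX dXn assms X(1) by (simp add: univ_poly_carrier)
qed

text \<open>In characteristic \<open>p\<close> one has \<open>X^n - X = (X - a)^n - (X - a)\<close> for every root \<open>a\<close>, so that
  dividing by \<open>X - a\<close> leaves \<open>-1\<close> modulo \<open>X - a\<close>.\<close>

lemma (in field) alg_mult_var_pow_minus_var:
  fixes p m :: nat
  defines "n \<equiv> p ^ m"
  assumes p: "Factorial_Ring.prime p" "[p] \<cdot> \<one> = \<zero>" and n: "n > 1"
    and a: "a \<in> carrier R" "a [^] n = a"
  shows "alg_mult (X [^]\<^bsub>poly_ring R\<^esub> n \<ominus>\<^bsub>poly_ring R\<^esub> X) a \<le> 1"
proof (rule ccontr)
  interpret UP: domain "poly_ring R"
    using univ_poly_is_domain[OF carrier_is_subring] .
  interpret const: ring_hom_ring R "poly_ring R" poly_of_const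
    using canonical_embedding_ring_hom[OF carrier_is_subring] by simp
  interpret E: ring_hom_cring "poly_ring R" R "\<lambda>p. eval p a"
    using eval_cring_hom[OF carrier_is_subring a(1)] .
  let ?P = "X [^]\<^bsub>poly_ring R\<^esub> n \<ominus>\<^bsub>poly_ring R\<^esub> X"
  let ?D = "[\<one>, \<ominus> a]"
  let ?c = "poly_of_const (\<ominus> a)"
  have X: "X \<in> carrier (poly_ring R)"
    using var_closed(1)[OF carrier_is_subring] .
  have P: "?P \<in> carrier (poly_ring R)" using X by simp
  have c: "?c \<in> carrier (poly_ring R)" using a(1) by simp
  have D: "?D = X \<oplus>\<^bsub>poly_ring R\<^esub> ?c"
    using a(1) by (auto simp: univ_poly_add var_def poly_of_const_def)
  have D_carrier: "?D \<in> carrier (poly_ring R)"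
    unfolding D using X c by simp
  \<comment> \<open>The polynomial ring inherits the characteristic, so \<open>n\<close>-th powers
    are additive there too.\<close>
  have p': "[p] \<cdot>\<^bsub>poly_ring R\<^esub> \<one>\<^bsub>poly_ring R\<^esub> = \<zero>\<^bsub>poly_ring R\<^esub>"
    using const.hom_add_pow[of "\<one>" p] p(2) by simp
  have "(\<ominus> a) [^] n = \<ominus> a"
    using prime_power_char_pow_minus[OF p a(1), of m] a(2) by (simp add: n_def)
  then have "?c [^]\<^bsub>poly_ring R\<^esub> n = ?c"
    using const.hom_nat_pow[of "\<ominus> a" n] a(1) by simp
  then have "?D [^]\<^bsub>poly_ring R\<^esub> n = X [^]\<^bsub>poly_ring R\<^esub> n \<oplus>\<^bsub>poly_ring R\<^esub> ?c"
    using UP.prime_power_char_pow_add[OF p(1) p' X c, of m] by (simp add: D n_def)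
  then have P_eq: "?P = ?D [^]\<^bsub>poly_ring R\<^esub> n \<ominus>\<^bsub>poly_ring R\<^esub> ?D"
    unfolding D using X c by (simp add: UP.minus_add_cancel_right)
  assume "\<not> alg_mult ?P a \<le> 1"
  then have "?D [^]\<^bsub>poly_ring R\<^esub> (2::nat) pdivides ?P"
    using le_alg_mult_imp_pdivides[OF a(1) P, of 2] by simp
  then obtain h where h: "h \<in> carrier (poly_ring R)"
    and "?P = ?D [^]\<^bsub>poly_ring R\<^esub> (2::nat) \<otimes>\<^bsub>poly_ring R\<^esub> h"
    unfolding pdivides_def by blast
  then have "?P = ?D \<otimes>\<^bsub>poly_ring R\<^esub> (?D \<otimes>\<^bsub>poly_ring R\<^esub> h)"
    using D_carrier by (simp add: numeral_2_eq_2 UP.m_assoc)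
  moreover have "?P = ?D \<otimes>\<^bsub>poly_ring R\<^esub>
      (?D [^]\<^bsub>poly_ring R\<^esub> (n - 1) \<ominus>\<^bsub>poly_ring R\<^esub> \<one>\<^bsub>poly_ring R\<^esub>)"
  proof -
    have "?D [^]\<^bsub>poly_ring R\<^esub> n = ?D \<otimes>\<^bsub>poly_ring R\<^esub> ?D [^]\<^bsub>poly_ring R\<^esub> (n - 1)"
      using UP.nat_pow_Suc2[OF D_carrier, of "n - 1"] n by simp
    moreover have "?D [^]\<^bsub>poly_ring R\<^esub> (n - 1) \<in> carrier (poly_ring R)"
      using D_carrier by simp
    ultimately show ?thesis
      unfolding P_eq using D_carrier by (simp add: UP.mult_minus_one_right)
  qed
  moreover have "?D \<noteq> \<zero>\<^bsub>poly_ring R\<^esub>" by (simp add: univ_poly_zero)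
  ultimately have "?D \<otimes>\<^bsub>poly_ring R\<^esub> h =
      ?D [^]\<^bsub>poly_ring R\<^esub> (n - 1) \<ominus>\<^bsub>poly_ring R\<^esub> \<one>\<^bsub>poly_ring R\<^esub>"
    using UP.m_lcancel[of ?D "?D \<otimes>\<^bsub>poly_ring R\<^esub> h"
        "?D [^]\<^bsub>poly_ring R\<^esub> (n - 1) \<ominus>\<^bsub>poly_ring R\<^esub> \<one>\<^bsub>poly_ring R\<^esub>"] D_carrier h
    by (metis UP.m_closed UP.minus_closed UP.nat_pow_closed UP.one_closed)
  \<comment> \<open>Evaluation at \<open>a\<close> turns the cancelled equation into
    \<open>\<zero> = \<ominus> \<one>\<close>; here \<open>n > 1\<close> keeps the exponent
    \<open>n - 1\<close> positive.\<close>
  then have "eval ?D a \<otimes> eval h a = eval ?D a [^] (n - 1) \<ominus> \<one>"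
    using E.hom_mult[OF D_carrier h] D_carrier by (simp add: a_minus_def del: eval.simps)
  moreover have "eval ?D a = \<zero>" using a(1) by (simp add: r_neg)
  moreover have "\<zero> [^] (n - 1) = \<zero>" using n by (simp add: nat_pow_zero)
  ultimately have "\<ominus> \<one> = \<zero>" using E.hom_closed[OF h] by (simp add: a_minus_def)
  then show False using one_not_zero by (metis add.inv_eq_1_iff one_closed)
qed

text \<open>\<open>X^n - X\<close> splits and its roots are simple, so its distinct roots are as
  many as its degree.\<close>

lemma (in algebraically_closed) card_pow_fixed_points:
  fixes p m :: nat
  defines "n \<equiv> p ^ m"
  assumes p: "Factorial_Ring.prime p" "[p] \<cdot> \<one> = \<zero>" and n: "n > 1"
  shows "finite {x \<in> carrier L. x [^] n = x}" and "card {x \<in> carrier L. x [^] n = x} = n"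
proof -
  interpret UP: domain "poly_ring L"
    using univ_poly_is_domain[OF carrier_is_subring] .
  let ?P = "X [^]\<^bsub>poly_ring L\<^esub> n \<ominus>\<^bsub>poly_ring L\<^esub> X"
  have P: "?P \<in> carrier (poly_ring L)"
    using var_closed(1)[OF carrier_is_subring] by simp
  have "?P \<noteq> []" using degree_var_pow_minus_var[OF n] n by auto
  then have root: "is_root ?P x \<longleftrightarrow> x \<in> carrier L \<and> x [^] n = x" for x
    unfolding is_root_def by (auto simp: eval_var_pow_minus_var)
  then have set: "set_mset (roots ?P) = {x \<in> carrier L. x [^] n = x}"
    using roots_mem_iff_is_root[OF P] by auto
  then show "finite {x \<in> carrier L. x [^] n = x}"
    using finite_set_mset[of "roots ?P"] by simp
  have "count (roots ?P) x = 1" if "x \<in># roots ?P" for x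
  proof -
    have "alg_mult ?P x \<le> 1"
      using alg_mult_var_pow_minus_var[OF p, of m x] that set n by (simp add: n_def)
    then have "count (roots ?P) x \<le> 1" using alg_mult_eq_count_roots[OF P] by simp
    moreover have "count (roots ?P) x > 0" using that by simp
    ultimately show ?thesis by linarith
  qed
  then have "size (roots ?P) = card {x \<in> carrier L. x [^] n = x}"
    by (simp add: size_multiset_overloaded_eq set)
  moreover have "size (roots ?P) = n"
    using roots_over_carrier[OF P] degree_var_pow_minus_var[OF n] by (simp add: splitted_def)
  ultimately show "card {x \<in> carrier L. x [^] n = x} = n" by simp
qed

text \<open>The field consists of the elements fixed by the \<open>p ^ m\<close>-th power in an
  algebraic closure of the integers modulo \<open>p\<close>; the type displayed is that of the
  closure.\<close>

theorem exists_finite_field: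
  fixes p m :: nat
  assumes "Factorial_Ring.prime p" "m > 0"
  shows "\<exists>K :: ((int list \<times> nat) multiset \<Rightarrow> int) ring.
    field K \<and> finite (carrier K) \<and> card (carrier K) = p ^ m \<and> [p] \<cdot>\<^bsub>K\<^esub> \<one>\<^bsub>K\<^esub> = \<zero>\<^bsub>K\<^esub>"
proof -
  define F where "F = residue_ring (int p)"
  interpret F: residues_prime p F
    using assms(1) by unfold_locales (simp_all add: F_def)
  interpret F: field F by (rule F.is_field)
  define L where "L = F.alg_closure"
  interpret L: algebraic_closure L "F.indexed_const ` carrier F"
    unfolding L_def by (rule F.alg_closureE)
  interpret emb: ring_hom_ring F L F.indexed_const
    using F.alg_closureE(2) F.ring_axioms L.ring_axioms
    by (simp add: ring_hom_ringI2 L_def)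
  have "[k] \<cdot>\<^bsub>F\<^esub> \<one>\<^bsub>F\<^esub> = int k mod int p" for k :: nat
    by (induction k) (auto simp: F.res_add_eq F.res_one_eq F.res_zero_eq mod_simps ac_simps)
  then have "[p] \<cdot>\<^bsub>F\<^esub> \<one>\<^bsub>F\<^esub> = \<zero>\<^bsub>F\<^esub>"
    by (simp add: F.res_zero_eq)
  then have p: "[p] \<cdot>\<^bsub>L\<^esub> \<one>\<^bsub>L\<^esub> = \<zero>\<^bsub>L\<^esub>"
    using emb.hom_add_pow[of "\<one>\<^bsub>F\<^esub>" p] by simp
  have n: "p ^ m > 1" using assms by (intro one_less_power prime_gt_1_nat)
  let ?H = "{x \<in> carrier L. x [^]\<^bsub>L\<^esub> (p ^ m) = x}"
  have "subfield ?H L"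
  proof (rule L.subfieldI'[OF L.subringI])
    fix x assume "x \<in> ?H"
    then show "\<ominus>\<^bsub>L\<^esub> x \<in> ?H"
      using L.prime_power_char_pow_minus[OF assms(1) p, of x m] by simp
  next
    fix x y assume "x \<in> ?H" "y \<in> ?H"
    then show "x \<otimes>\<^bsub>L\<^esub> y \<in> ?H" "x \<oplus>\<^bsub>L\<^esub> y \<in> ?H"
      using L.prime_power_char_pow_add[OF assms(1) p, of x y m]
      by (auto simp: L.nat_pow_distrib)
  next
    fix x assume x: "x \<in> ?H - {\<zero>\<^bsub>L\<^esub>}"
    then have U: "x \<in> Units L" by (simp add: L.field_Units)
    have "x [^]\<^bsub>L\<^esub> (p ^ m) \<otimes>\<^bsub>L\<^esub> (inv\<^bsub>L\<^esub> x) [^]\<^bsub>L\<^esub> (p ^ m) = (x \<otimes>\<^bsub>L\<^esub> inv\<^bsub>L\<^esub> x) [^]\<^bsub>L\<^esub> (p ^ m)"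
      using U by (intro L.nat_pow_distrib[symmetric]) (auto simp: L.Units_closed)
    then have "x \<otimes>\<^bsub>L\<^esub> (inv\<^bsub>L\<^esub> x) [^]\<^bsub>L\<^esub> (p ^ m) = \<one>\<^bsub>L\<^esub>"
      using U x by (simp add: L.nat_pow_one)
    \<comment> \<open>Both sides are inverses of \<open>x\<close>.\<close>
    then have "inv\<^bsub>L\<^esub> x = (inv\<^bsub>L\<^esub> x) [^]\<^bsub>L\<^esub> (p ^ m)"
      using U by (intro L.comm_inv_char) auto
    then show "inv\<^bsub>L\<^esub> x \<in> ?H" using U by simp
  qed auto
  then have "field (L\<lparr>carrier := ?H\<rparr>)" using L.subfield_iff(2) by blast
  \<comment> \<open>Multiples use only the ring operations, so restricting the carrier keeps the
    characteristic.\<close>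
  moreover have "[k] \<cdot>\<^bsub>L\<lparr>carrier := ?H\<rparr>\<^esub> x = [k] \<cdot>\<^bsub>L\<^esub> x" for k :: nat and x
    by (simp add: add_pow_def nat_pow_def)
  ultimately show ?thesis
    using L.card_pow_fixed_points[OF assms(1) p n] p
    by (intro exI[of _ "L\<lparr>carrier := ?H\<rparr>"]) simp
qed

section \<open>The field with \<open>q\<^sup>2\<close> elements\<close>

locale quadratic_finite_field = field K for K (structure) +
  fixes q :: nat
  assumes q_gt_1: "1 < q"
    and finite_K: "finite (carrier K)" and card_K: "card (carrier K) = q\<^sup>2"
    and pow_q_add: "\<lbrakk>x \<in> carrier K; y \<in> carrier K\<rbrakk> \<Longrightarrow> (x \<oplus> y) [^] q = x [^] q \<oplus> y [^] q"
begin

definition U :: "'a set" where "U = {u \<in> carrier K. u [^] q \<otimes> u = \<one>}"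

text \<open>For \<open>w\<close> in \<open>U\<close> these are the one-dimensional subspaces of the
  field over \<open>Fix \<one>\<close>, its subfield of order \<open>q\<close>.\<close>

definition Fix :: "'a \<Rightarrow> 'a set" where "Fix w = {t \<in> carrier K. t [^] q = w \<otimes> t}"

definition cosets :: "'a \<Rightarrow> 'a set set" where
  "cosets w = (\<lambda>b. {z \<in> carrier K. z \<ominus> b \<in> Fix w}) ` carrier K"

lemma zero_pow_q [simp]: "\<zero> [^] q = \<zero>"
  using q_gt_1 by (simp add: nat_pow_zero)

lemma pow_q_minus: "x \<in> carrier K \<Longrightarrow> (\<ominus> x) [^] q = \<ominus> (x [^] q)"
  using pow_q_add[of "\<ominus> x" x] by (simp add: l_neg minus_equality)

lemma pow_q_diff: "\<lbrakk>x \<in> carrier K; y \<in> carrier K\<rbrakk> \<Longrightarrow> (x \<ominus> y) [^] q = x [^] q \<ominus> y [^] q"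
  by (simp add: a_minus_def pow_q_add pow_q_minus)

lemma pow_q2_minus_1:
  assumes "x \<in> carrier K" "x \<noteq> \<zero>"
  shows "x [^] (q\<^sup>2 - 1) = \<one>"
proof -
  interpret G: group "Multiplicative_Group.mult_of K" by (rule field_mult_group)
  have "order (Multiplicative_Group.mult_of K) = q\<^sup>2 - 1"
    using card_K finite_K by (simp add: order_def carrier_mult_of card_Diff_singleton)
  then show ?thesis
    using G.pow_order_eq_1[of x] assms
    by (simp add: order_def carrier_mult_of Multiplicative_Group.nat_pow_mult_of one_mult_of)
qed

lemma pow_q_pow_q: "x \<in> carrier K \<Longrightarrow> (x [^] q) [^] q = x"
proof (cases "x = \<zero>")
  case False
  assume x: "x \<in> carrier K"
  have "q\<^sup>2 = Suc (q\<^sup>2 - 1)" using q_gt_1 by simp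
  then have "x [^] q\<^sup>2 = x [^] (q\<^sup>2 - 1) \<otimes> x" by (metis nat_pow_Suc)
  then show ?thesis
    using x pow_q2_minus_1[OF x False] by (simp add: nat_pow_pow power2_eq_square)
qed simp

lemma pow_q_inj: "\<lbrakk>x \<in> carrier K; y \<in> carrier K; x [^] q = y [^] q\<rbrakk> \<Longrightarrow> x = y"
  by (metis pow_q_pow_q)

lemma U_carrier: "u \<in> U \<Longrightarrow> u \<in> carrier K" and U_norm: "u \<in> U \<Longrightarrow> u [^] q \<otimes> u = \<one>"
  by (auto simp: U_def)

lemma U_nonzero: "u \<in> U \<Longrightarrow> u \<noteq> \<zero>"
  by (auto simp: U_def)

lemma U_one: "\<one> \<in> U"
  by (simp add: U_def)

lemma U_mult: "\<lbrakk>u \<in> U; w \<in> U\<rbrakk> \<Longrightarrow> u \<otimes> w \<in> U"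
proof -
  assume u: "u \<in> U" and w: "w \<in> U"
  note c = U_carrier[OF u] U_carrier[OF w]
  have "(u \<otimes> w) [^] q \<otimes> (u \<otimes> w) = (u [^] q \<otimes> u) \<otimes> (w [^] q \<otimes> w)"
    using c by (simp add: nat_pow_distrib m_ac)
  then show "u \<otimes> w \<in> U" using u w c by (simp add: U_def)
qed

lemma FixI: "\<lbrakk>t \<in> carrier K; t [^] q = w \<otimes> t\<rbrakk> \<Longrightarrow> t \<in> Fix w"
  and Fix_carrier: "t \<in> Fix w \<Longrightarrow> t \<in> carrier K"
  and Fix_pow: "t \<in> Fix w \<Longrightarrow> t [^] q = w \<otimes> t"
  by (auto simp: Fix_def)

lemma Fix_zero: "w \<in> carrier K \<Longrightarrow> \<zero> \<in> Fix w"
  by (simp add: Fix_def)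

lemma Fix_add: "\<lbrakk>w \<in> carrier K; s \<in> Fix w; t \<in> Fix w\<rbrakk> \<Longrightarrow> s \<oplus> t \<in> Fix w"
  by (auto simp: Fix_def pow_q_add r_distr)

lemma Fix_diff: "\<lbrakk>w \<in> carrier K; s \<in> Fix w; t \<in> Fix w\<rbrakk> \<Longrightarrow> s \<ominus> t \<in> Fix w"
proof -
  assume *: "w \<in> carrier K" "s \<in> Fix w" "t \<in> Fix w"
  note c = Fix_carrier[OF *(2)] Fix_carrier[OF *(3)] *(1)
  have "w \<otimes> s \<ominus> w \<otimes> t = w \<otimes> (s \<ominus> t)" using c by algebra
  then show "s \<ominus> t \<in> Fix w" using * c by (intro FixI) (simp_all add: pow_q_diff Fix_pow)
qed

lemma Fix_unique:
  assumes "t \<in> Fix w" "t \<in> Fix w'" "t \<noteq> \<zero>" "w \<in> carrier K" "w' \<in> carrier K"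
  shows "w = w'"
proof -
  have "w \<otimes> t = w' \<otimes> t" using assms(1,2) by (auto simp: Fix_def)
  then show ?thesis using assms Fix_carrier m_rcancel by metis
qed

text \<open>Compute the \<open>q\<close>-th power of \<open>f \<otimes> g\<close> in two ways and
  cancel \<open>w \<otimes> f\<close>.\<close>

lemma Fix_quotient:
  assumes "f \<in> Fix w" "f \<noteq> \<zero>" "w \<in> U" "g \<in> carrier K" "f \<otimes> g \<in> Fix w"
  shows "g \<in> Fix \<one>"
proof -
  note c = Fix_carrier[OF assms(1)] U_carrier[OF assms(3)] assms(4)
  have "f [^] q \<otimes> g [^] q = w \<otimes> (f \<otimes> g)"
    using Fix_pow[OF assms(5)] c by (simp add: nat_pow_distrib)
  then have "(w \<otimes> f) \<otimes> g [^] q = (w \<otimes> f) \<otimes> g"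
    using Fix_pow[OF assms(1)] c by (simp add: m_assoc)
  moreover have "w \<otimes> f \<noteq> \<zero>" using assms U_nonzero c integral by blast
  ultimately have "g [^] q = g" using c m_lcancel[of "w \<otimes> f" "g [^] q" g] by simp
  then show ?thesis using c by (auto intro: FixI)
qed

text \<open>The norm of \<open>t [^] (q - 1)\<close> is the power of \<open>t\<close> with exponent
  \<open>q^2 - 1\<close>, which is one. With \<open>Fix_unique\<close>, the nonzero elements are
  thus partitioned by the sets \<open>Fix w\<close>.\<close>

lemma in_Fix_quotient_power:
  assumes "t \<in> carrier K" "t \<noteq> \<zero>"
  shows "t [^] (q - 1) \<in> U" "t \<in> Fix (t [^] (q - 1))"
proof -
  have q: "q = Suc (q - 1)" using q_gt_1 by simp
  have "(q - 1) * q + (q - 1) = q\<^sup>2 - 1"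
    using q_gt_1 by (simp add: power2_eq_square algebra_simps)
  then have "(t [^] (q - 1)) [^] q \<otimes> t [^] (q - 1) = \<one>"
    using pow_q2_minus_1[OF assms] assms(1) by (simp add: nat_pow_pow nat_pow_mult)
  then show "t [^] (q - 1) \<in> U" using assms(1) by (simp add: U_def)
  have "t [^] q = t [^] (q - 1) \<otimes> t" using q by (metis nat_pow_Suc)
  then show "t \<in> Fix (t [^] (q - 1))" using assms(1) by (rule FixI[rotated])
qed

section \<open>Sizes of \<open>U\<close> and \<open>Fix w\<close>, from root bounds and one
  partition\<close>

lemma finite_U: "finite U" and finite_Fix: "finite (Fix w)"
  using finite_K by (auto simp: U_def Fix_def)

lemma card_U_le: "card U \<le> q + 1"
proof -
  have "U = {x \<in> carrier K. x [^] (q + 1) = \<one>}" by (auto simp: U_def)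
  then show ?thesis using num_roots_le_deg[OF finite_K, of "q + 1"] by simp
qed

text \<open>All nonzero \<open>t\<close> in \<open>Fix w\<close> have
  \<open>t [^] (q - 1) = w\<close>, so division by a fixed one maps them injectively to the roots of
  unity of exponent \<open>q - 1\<close>.\<close>

lemma card_Fix_le:
  assumes "w \<in> U"
  shows "card (Fix w - {\<zero>}) \<le> q - 1"
proof (cases "Fix w - {\<zero>} = {}")
  case False
  then obtain t0 where t0: "t0 \<in> Fix w" "t0 \<noteq> \<zero>" by blast
  note c = Fix_carrier[OF t0(1)]
  have U: "t0 \<in> Units K" using c t0 by (simp add: field_Units)
  have pow: "t [^] (q - 1) = w" if "t \<in> Fix w - {\<zero>}" for t
    using Fix_unique[of t "t [^] (q - 1)" w] in_Fix_quotient_power[of t] that assms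
      Fix_carrier U_carrier by auto
  have "(\<lambda>t. t \<otimes> inv t0) ` (Fix w - {\<zero>}) \<subseteq> {x \<in> carrier K. x [^] (q - 1) = \<one>}"
  proof clarsimp
    fix t assume t: "t \<in> Fix w" "t \<noteq> \<zero>"
    have "(t \<otimes> inv t0) [^] (q - 1) = t0 [^] (q - 1) \<otimes> (inv t0) [^] (q - 1)"
      using pow[of t] pow[of t0] t t0 U Fix_carrier[OF t(1)] by (simp add: nat_pow_distrib)
    also have "\<dots> = (t0 \<otimes> inv t0) [^] (q - 1)"
      using c U by (intro nat_pow_distrib[symmetric]) auto
    finally show "t \<otimes> inv t0 \<in> carrier K \<and> (t \<otimes> inv t0) [^] (q - Suc 0) = \<one>"
      using U Fix_carrier[OF t(1)] by simp
  qed
  moreover have "inj_on (\<lambda>t. t \<otimes> inv t0) (Fix w - {\<zero>})"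
  proof (rule inj_onI)
    fix s t assume st: "s \<in> Fix w - {\<zero>}" "t \<in> Fix w - {\<zero>}" "s \<otimes> inv t0 = t \<otimes> inv t0"
    moreover have "inv t0 \<noteq> \<zero>" using U by (metis Units_r_inv c r_null zero_not_one)
    ultimately show "s = t" using m_rcancel[of "inv t0" s t] U Fix_carrier by blast
  qed
  ultimately have "card (Fix w - {\<zero>}) \<le> card {x \<in> carrier K. x [^] (q - 1) = \<one>}"
    using finite_K by (intro card_inj_on_le) auto
  also have "\<dots> \<le> q - 1" using num_roots_le_deg[OF finite_K, of "q - 1"] q_gt_1 by simp
  finally show ?thesis .
qed (simp only: card.empty)

lemma sum_card_Fix: "(\<Sum>w\<in>U. card (Fix w - {\<zero>})) = (q + 1) * (q - 1)"
proof -
  have "carrier K - {\<zero>} = (\<Union>w\<in>U. Fix w - {\<zero>})"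
    using in_Fix_quotient_power Fix_carrier by blast
  then have "card (carrier K - {\<zero>}) = card (\<Union>w\<in>U. Fix w - {\<zero>})" by simp
  also have "\<dots> = (\<Sum>w\<in>U. card (Fix w - {\<zero>}))"
  proof (rule card_UN_disjoint)
    show "\<forall>w\<in>U. \<forall>w'\<in>U. w \<noteq> w' \<longrightarrow> (Fix w - {\<zero>}) \<inter> (Fix w' - {\<zero>}) = {}"
      using Fix_unique U_carrier by blast
  qed (use finite_U finite_Fix in auto)
  finally show ?thesis
    using card_K finite_K by (simp add: card_Diff_singleton algebra_simps power2_eq_square)
qed

text \<open>The \<open>q^2 - 1\<close> nonzero elements, at most \<open>q - 1\<close> in each
  \<open>Fix w\<close>, force at least \<open>q + 1\<close> sets.\<close>

lemma card_U: "card U = q + 1"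
proof -
  have "(q + 1) * (q - 1) \<le> card U * (q - 1)"
    using sum_bounded_above[of U "\<lambda>w. card (Fix w - {\<zero>})" "q - 1"] card_Fix_le sum_card_Fix by simp
  then have "q + 1 \<le> card U" using q_gt_1 by (simp only: mult_le_cancel2)
  then show ?thesis using card_U_le by simp
qed

text \<open>The sum in \<open>sum_card_Fix\<close> attains its upper bound, so no summand falls
  short.\<close>

lemma card_Fix_nonzero:
  assumes "w \<in> U"
  shows "card (Fix w - {\<zero>}) = q - 1"
proof (rule ccontr)
  assume "card (Fix w - {\<zero>}) \<noteq> q - 1"
  then have "card (Fix w - {\<zero>}) < q - 1" using card_Fix_le[OF assms] by simp
  then have "(\<Sum>w\<in>U. card (Fix w - {\<zero>})) < (\<Sum>w\<in>U. q - 1)"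
    using assms card_Fix_le finite_U by (intro sum_strict_mono_ex1) blast+
  then show False using sum_card_Fix card_U by simp
qed

lemma card_Fix:
  assumes "w \<in> U"
  shows "card (Fix w) = q"
  using card_Fix_nonzero[OF assms] Fix_zero[OF U_carrier[OF assms]] finite_Fix q_gt_1
  by (simp add: card_Diff_singleton)

section \<open>Cosets of \<open>Fix w\<close> as lines of an affine plane\<close>

lemma coset_subset: "B \<in> cosets w \<Longrightarrow> B \<subseteq> carrier K"
  by (auto simp: cosets_def)

lemma coset_diff:
  assumes "w \<in> U" "B \<in> cosets w" "x \<in> B" "y \<in> B"
  shows "x \<ominus> y \<in> Fix w"
proof -
  obtain b where b: "b \<in> carrier K" "x \<ominus> b \<in> Fix w" "y \<ominus> b \<in> Fix w" "x \<in> carrier K" "y \<in> carrier K"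
    using assms by (auto simp: cosets_def)
  then have "x \<ominus> y = (x \<ominus> b) \<ominus> (y \<ominus> b)" by algebra
  then show ?thesis using b Fix_diff[OF U_carrier[OF assms(1)]] by simp
qed

lemma coset_closed:
  assumes "w \<in> U" "B \<in> cosets w" "x \<in> B" "y \<in> carrier K" "y \<ominus> x \<in> Fix w"
  shows "y \<in> B"
proof -
  obtain b where b: "B = {z \<in> carrier K. z \<ominus> b \<in> Fix w}" "b \<in> carrier K"
    using assms by (auto simp: cosets_def)
  then have x: "x \<in> carrier K" "x \<ominus> b \<in> Fix w" using assms(3) by auto
  then have "y \<ominus> b = (y \<ominus> x) \<oplus> (x \<ominus> b)" using b(2) assms(4) by algebra
  then show ?thesis using b assms x Fix_add[OF U_carrier[OF assms(1)]] by simp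
qed

lemma coset_unique:
  assumes "w \<in> U" "B \<in> cosets w" "B' \<in> cosets w" "x \<in> B" "x \<in> B'"
  shows "B = B'"
proof -
  have "C \<subseteq> D" if "C \<in> cosets w" "D \<in> cosets w" "x \<in> C" "x \<in> D" for C D
    using coset_closed[OF assms(1) that(2,4)] coset_diff[OF assms(1) that(1) _ that(3)]
      coset_subset[OF that(1)] by blast
  then show ?thesis using assms by blast
qed

lemma card_coset:
  assumes "w \<in> U" "B \<in> cosets w"
  shows "card B = q"
proof -
  obtain b where b: "B = {z \<in> carrier K. z \<ominus> b \<in> Fix w}" "b \<in> carrier K"
    using assms by (auto simp: cosets_def)
  have "bij_betw (\<lambda>z. z \<ominus> b) B (Fix w)"
  proof (rule bij_betwI)
    show "(\<lambda>z. z \<ominus> b) \<in> B \<rightarrow> Fix w" using b by auto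
    have *: "z \<oplus> b \<ominus> b = z" if "z \<in> carrier K" for z using that b(2) by algebra
    show "(\<lambda>t. t \<oplus> b) \<in> Fix w \<rightarrow> B" using b Fix_carrier * by auto
    show "z \<ominus> b \<oplus> b = z" if "z \<in> B" for z
    proof -
      have "z \<in> carrier K" using that b by simp
      then show ?thesis using b(2) by algebra
    qed
    show "t \<oplus> b \<ominus> b = t" if "t \<in> Fix w" for t using * Fix_carrier[OF that] .
  qed
  then show ?thesis using bij_betw_same_card card_Fix[OF assms(1)] by metis
qed

lemma finite_cosets: "finite (cosets w)"
  using finite_K by (simp add: cosets_def)

lemma coset_exists:
  assumes "w \<in> U" "z \<in> carrier K"
  obtains B where "B \<in> cosets w" "z \<in> B"
proof
  show "{x \<in> carrier K. x \<ominus> z \<in> Fix w} \<in> cosets w" using assms by (auto simp: cosets_def)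
  show "z \<in> {x \<in> carrier K. x \<ominus> z \<in> Fix w}"
    using assms(2) Fix_zero[OF U_carrier[OF assms(1)]] by (simp add: a_minus_def r_neg)
qed

lemma card_cosets:
  assumes "w \<in> U"
  shows "card (cosets w) = q"
proof -
  have "\<Union>(cosets w) = carrier K"
    using coset_subset coset_exists[OF assms] by blast
  then have "q * card (cosets w) = card (carrier K)"
    using card_partition[of "cosets w" q] finite_cosets finite_K card_coset[OF assms]
      coset_unique[OF assms] by (metis disjoint_iff)
  then show ?thesis using card_K q_gt_1 by (simp add: power2_eq_square)
qed

end

section \<open>Existence of \<alpha> and \<beta> avoiding the subfield of order
  \<open>q\<close>\<close>

context quadratic_finite_field
begin

text \<open>With \<open>\<beta>^q = w \<beta>\<close>, the element \<open>\<beta> u\<close> is fixed by \<open>q\<close>-th powers iff \<open>w = u^2\<close>.\<close>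

lemma exists_avoiding_pair_odd:
  assumes "\<ominus> \<one> \<noteq> \<one>"
  shows "\<exists>\<alpha>\<in>carrier K. \<exists>\<beta>\<in>carrier K. \<beta> \<noteq> \<zero> \<and> (\<forall>u\<in>U. \<alpha> \<oplus> \<beta> \<otimes> u \<notin> Fix \<one>)"
proof -
  have "(\<ominus> \<one>) [^] q \<otimes> (\<ominus> \<one>) = \<one>" by (simp add: pow_q_minus l_minus r_minus)
  then have "\<ominus> \<one> \<in> U" by (simp add: U_def)
  moreover have "\<ominus> \<one> \<otimes> \<ominus> \<one> = \<one> \<otimes> \<one>" by (simp add: l_minus r_minus)
  \<comment> \<open>Squaring identifies \<open>\<one>\<close> and \<open>\<ominus> \<one>\<close>,
    so on the finite set \<open>U\<close> it is not onto and misses some \<open>w\<close>.\<close>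
  ultimately have "\<not> inj_on (\<lambda>u. u \<otimes> u) U"
    using assms U_one inj_onD[of "\<lambda>u. u \<otimes> u" U "\<ominus> \<one>" "\<one>"] by blast
  then have "(\<lambda>u. u \<otimes> u) ` U \<noteq> U"
    using finite_U by (metis eq_card_imp_inj_on)
  then obtain w where w: "w \<in> U" "\<And>u. u \<in> U \<Longrightarrow> u \<otimes> u \<noteq> w"
    using U_mult by blast
  have "card (Fix w - {\<zero>}) > 0" using card_Fix_nonzero[OF w(1)] q_gt_1 by simp
  then have "Fix w - {\<zero>} \<noteq> {}" by (metis card.empty less_irrefl)
  then obtain \<beta> where \<beta>: "\<beta> \<in> Fix w" "\<beta> \<noteq> \<zero>" by blast
  note c = Fix_carrier[OF \<beta>(1)] U_carrier[OF w(1)]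
  \<comment> \<open>The witness for \<alpha> is zero.\<close>
  have "\<zero> \<oplus> \<beta> \<otimes> u \<notin> Fix \<one>" if u: "u \<in> U" for u
  proof
    note cu = U_carrier[OF u]
    assume "\<zero> \<oplus> \<beta> \<otimes> u \<in> Fix \<one>"
    then have "\<beta> \<otimes> u \<in> Fix \<one>" using c cu by simp
    then have "w \<otimes> \<beta> \<otimes> u [^] q = \<beta> \<otimes> u"
      using Fix_pow[of "\<beta> \<otimes> u" "\<one>"] Fix_pow[OF \<beta>(1)] c cu by (simp add: nat_pow_distrib)
    then have "\<beta> \<otimes> (w \<otimes> u [^] q) = \<beta> \<otimes> u" using c cu by (simp add: m_ac)
    then have "w \<otimes> u [^] q = u" using c cu \<beta>(2) by (simp add: m_lcancel)
    then have "w \<otimes> u [^] q \<otimes> u = u \<otimes> u" by simp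
    then have "w = u \<otimes> u" using U_norm[OF u] c cu by (simp add: m_assoc)
    then show False using w(2)[OF u] by simp
  qed
  then show ?thesis using c \<beta>(2) by blast
qed

text \<open>Take \<open>\<beta> = 1\<close> and \<open>\<alpha>\<close> of trace \<open>c + 1/c\<close> with \<open>c \<notin> {0, 1}\<close> in the subfield of order \<open>q\<close>:
  if \<open>\<alpha> + u\<close> were in the subfield, then \<open>u + 1/u = c + 1/c\<close>, hence \<open>u = c\<close> or \<open>u = 1/c\<close>.\<close>

lemma exists_avoiding_pair_even:
  assumes char: "\<ominus> \<one> = \<one>" and "q > 2"
  shows "\<exists>\<alpha>\<in>carrier K. \<exists>\<beta>\<in>carrier K. \<beta> \<noteq> \<zero> \<and> (\<forall>u\<in>U. \<alpha> \<oplus> \<beta> \<otimes> u \<notin> Fix \<one>)"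
proof -
  have neg: "\<ominus> x = x" if "x \<in> carrier K" for x
    using that char l_minus[of "\<one>" x] by simp
  have F_pow: "x [^] q = x" if "x \<in> Fix \<one>" for x
    using Fix_pow[OF that] Fix_carrier[OF that] by simp
  \<comment> \<open>This is where \<open>q > 2\<close> enters: it leaves room for
    \<open>c\<close>.\<close>
  have "card (Fix \<one> - {\<zero>, \<one>}) > 0"
    using card_Fix[OF U_one] \<open>q > 2\<close> finite_Fix
    by (subst card_Diff_subset) (auto simp: Fix_zero FixI)
  then have "Fix \<one> - {\<zero>, \<one>} \<noteq> {}" by (metis card.empty less_irrefl)
  then obtain c where c: "c \<in> Fix \<one>" "c \<noteq> \<zero>" "c \<noteq> \<one>" by blast
  note cc = Fix_carrier[OF c(1)]
  define d where "d = inv c"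
  have cU: "c \<in> Units K" using cc c by (simp add: field_Units)
  have d: "d \<in> carrier K" "c \<otimes> d = \<one>" using cU by (simp_all add: d_def)
  have "c \<otimes> d [^] q = \<one>"
    using F_pow[OF c(1)] nat_pow_distrib[OF cc d(1), of q] d by simp
  then have dF: "d [^] q = d" using cU cc d by (metis comm_inv_char d_def nat_pow_closed)
  have "Fix \<one> \<noteq> carrier K"
    using card_Fix[OF U_one] card_K \<open>q > 2\<close> by (auto simp: power2_eq_square)
  then obtain g where g: "g \<in> carrier K" "g \<notin> Fix \<one>" using Fix_carrier by blast
  \<comment> \<open>The trace \<open>t\<close> of \<open>g\<close> lies in the subfield, and it is
    nonzero because \<open>g [^] q = \<ominus> g = g\<close> would put \<open>g\<close> there.
    Scaling \<open>g\<close> by \<open>(c \<oplus> d) \<otimes> inv t\<close> then gives trace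
    \<open>c \<oplus> d\<close>.\<close>
  define t where "t = g \<oplus> g [^] q"
  have t: "t \<in> carrier K" "t [^] q = t"
    using g(1) by (simp_all add: t_def pow_q_add pow_q_pow_q a_comm)
  have "t \<noteq> \<zero>"
  proof
    assume "t = \<zero>"
    then have "g [^] q = \<ominus> g" using g(1) minus_equality[of "g [^] q" g] by (simp add: t_def a_comm)
    then show False using g neg by (simp add: FixI)
  qed
  then have tU: "t \<in> Units K" using t by (simp add: field_Units)
  define s where "s = inv t"
  have s: "s \<in> carrier K" "t \<otimes> s = \<one>" using tU by (simp_all add: s_def)
  have "t \<otimes> s [^] q = \<one>"
    using nat_pow_distrib[OF t(1) s(1), of q] s t by simp
  then have sF: "s [^] q = s" using tU t s by (metis comm_inv_char s_def nat_pow_closed)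
  define \<alpha> where "\<alpha> = (c \<oplus> d) \<otimes> s \<otimes> g"
  have \<alpha>: "\<alpha> \<in> carrier K" using cc d s g by (simp add: \<alpha>_def)
  have "\<alpha> [^] q = (c \<oplus> d) \<otimes> s \<otimes> g [^] q"
    using cc d s g sF dF F_pow[OF c(1)] by (simp add: \<alpha>_def nat_pow_distrib pow_q_add)
  moreover have dist: "x \<otimes> s \<otimes> g \<oplus> x \<otimes> s \<otimes> h = x \<otimes> ((g \<oplus> h) \<otimes> s)"
    if "x \<in> carrier K" "h \<in> carrier K" for x h
    using that s(1) g(1) by algebra
  ultimately have "\<alpha> \<oplus> \<alpha> [^] q = (c \<oplus> d) \<otimes> (t \<otimes> s)"
    using dist[of "c \<oplus> d" "g [^] q"] cc d(1) g(1) by (simp add: t_def \<alpha>_def)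
  then have trace: "\<alpha> \<oplus> \<alpha> [^] q = c \<oplus> d" using cc d s by simp
  have "\<alpha> \<oplus> \<one> \<otimes> u \<notin> Fix \<one>" if u: "u \<in> U" for u
  proof
    note cu = U_carrier[OF u]
    assume "\<alpha> \<oplus> \<one> \<otimes> u \<in> Fix \<one>"
    then have "\<alpha> [^] q \<oplus> u [^] q = \<alpha> \<oplus> u"
      using F_pow[of "\<alpha> \<oplus> u"] \<alpha> cu by (simp add: pow_q_add)
    \<comment> \<open>This holds in every commutative ring. The first difference on the right is
      zero by the previous line, and the two equal summands cancel in characteristic 2.\<close>
    moreover have "\<alpha> \<oplus> \<alpha> [^] q \<ominus> (u \<oplus> u [^] q) =
        (\<alpha> [^] q \<oplus> u [^] q) \<ominus> (\<alpha> \<oplus> u) \<oplus> (\<alpha> \<ominus> u [^] q) \<oplus> (\<alpha> \<ominus> u [^] q)"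
      using \<alpha> cu nat_pow_closed[OF \<alpha>, of q] nat_pow_closed[OF cu, of q] by algebra
    moreover have "x \<oplus> x = \<zero>" if "x \<in> carrier K" for x
      using neg[OF that] r_neg[OF that] by simp
    ultimately have "c \<oplus> d \<ominus> (u \<oplus> u [^] q) = \<zero>"
      using \<alpha> cu trace by (simp add: a_assoc r_neg a_minus_def)
    then have tr: "c \<oplus> d = u \<oplus> u [^] q" using cc d cu by simp
    \<comment> \<open>\<open>c\<close> and \<open>d\<close> have the same sum and product as
      \<open>u\<close> and \<open>u [^] q\<close>, so \<open>u\<close> is one of them.\<close>
    have "(u \<ominus> c) \<otimes> (u \<ominus> d) = u \<otimes> u \<ominus> u \<otimes> (c \<oplus> d) \<oplus> c \<otimes> d"
      using cu cc d by algebra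
    also have "\<dots> = u \<otimes> u \<ominus> u \<otimes> (u \<oplus> u [^] q) \<oplus> u [^] q \<otimes> u"
      using tr d(2) U_norm[OF u] by simp
    also have "\<dots> = \<zero>" using cu nat_pow_closed[OF cu, of q] by algebra
    finally have "u = c \<or> u = d" using cu cc d integral[of "u \<ominus> c" "u \<ominus> d"] by auto
    \<comment> \<open>Being \<open>c\<close> or \<open>d\<close>, \<open>u\<close> equals its own
      \<open>q\<close>-th power, so its norm is its square.\<close>
    then have "u \<otimes> u = \<one>" using U_norm[OF u] dF F_pow[OF c(1)] by auto
    then have "(u \<ominus> \<one>) \<otimes> (u \<oplus> \<one>) = \<zero>" using cu by algebra
    then have "u \<ominus> \<one> = \<zero> \<or> u \<oplus> \<one> = \<zero>" using cu by (simp add: integral_iff)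
    then have "u = \<one>" using cu char by (auto simp: minus_equality dest: minus_equality)
    then show False using \<open>u = c \<or> u = d\<close> c(3) d cc by auto
  qed
  then show ?thesis using \<alpha> by (intro bexI[of _ \<alpha>] bexI[of _ "\<one>"]) auto
qed

end

section \<open>The parallelism of \<open>PG(3,q)\<close> for \<open>q > 2\<close>\<close>

locale avoiding_pair = quadratic_finite_field +
  fixes \<alpha> \<beta>
  assumes \<alpha>: "\<alpha> \<in> carrier K" and \<beta>: "\<beta> \<in> carrier K" "\<beta> \<noteq> \<zero>"
    and avoiding: "u \<in> U \<Longrightarrow> \<alpha> \<oplus> \<beta> \<otimes> u \<notin> Fix \<one>"
begin

text \<open>Second coordinate over \<open>u\<close> on the line \<open>(f, s)\<close> of a derived
  spread; it is affine in \<open>u\<close> with slope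
  \<open>w \<otimes> f \<otimes> \<beta>\<close>.\<close>

definition height :: "'a \<Rightarrow> 'a \<Rightarrow> 'a \<Rightarrow> 'a \<Rightarrow> 'a" where
  "height w f s u = s \<oplus> f \<otimes> (\<alpha> \<oplus> \<beta> \<otimes> (u \<otimes> w))"

definition pts :: "('a + 'a \<times> 'a) set" where
  "pts = Sum_Type.Plus U (U \<times> carrier K)"

definition nodes :: "('a \<times> 'a set) option set" where
  "nodes = insert None (Some ` (SIGMA w:U. cosets w))"

text \<open>Labels name the lines of a spread. In the regular spread \<open>None\<close>,
  \<open>\<one>\<close> and \<open>\<zero>\<close> are placeholders: \<open>Inl \<one>\<close> names
  the line \<open>x = 0\<close> and \<open>Inr (\<zero>, z)\<close> the line
  \<open>y = z x\<close>.\<close>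

fun labels :: "('a \<times> 'a set) option \<Rightarrow> ('a + 'a \<times> 'a) set" where
  "labels None = Sum_Type.Plus {\<one>} ({\<zero>} \<times> carrier K)"
| "labels (Some (w, B)) = Sum_Type.Plus U ((Fix w - {\<zero>}) \<times> B)"

fun blk :: "('a \<times> 'a set) option \<Rightarrow> 'a + 'a \<times> 'a \<Rightarrow> ('a + 'a \<times> 'a) set" where
  "blk None (Inl _) = Inl ` U"
| "blk None (Inr (_, z)) = (\<lambda>u. Inr (u, z)) ` U"
| "blk (Some (w, B)) (Inl u) = insert (Inl (u \<otimes> w)) ((\<lambda>z. Inr (u, z)) ` B)"
| "blk (Some (w, B)) (Inr (f, s)) = (\<lambda>u. Inr (u, height w f s u)) ` U"

text \<open>The projective completion of the affine plane: \<open>Inr w\<close> is the point at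
  infinity of direction \<open>w\<close>, and \<open>None\<close> the line at infinity.\<close>

fun rows :: "('a \<times> 'a set) option \<Rightarrow> ('a + 'a) set" where
  "rows None = Inr ` U"
| "rows (Some (w, B)) = insert (Inr w) (Inl ` B)"

lemma nodesE:
  assumes "k \<in> nodes"
  obtains "k = None" | w B where "k = Some (w, B)" "w \<in> U" "B \<in> cosets w"
  using assms by (auto simp: nodes_def)

lemma height_closed:
  "\<lbrakk>w \<in> U; f \<in> Fix w; s \<in> carrier K; u \<in> U\<rbrakk> \<Longrightarrow> height w f s u \<in> carrier K"
  by (simp add: height_def U_carrier Fix_carrier \<alpha> \<beta>)

lemma avoiding_mult:
  assumes "w \<in> U" "u \<in> U" "f \<in> Fix w" "f \<noteq> \<zero>"
  shows "f \<otimes> (\<alpha> \<oplus> \<beta> \<otimes> (u \<otimes> w)) \<notin> Fix w"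
  using Fix_quotient[of f w "\<alpha> \<oplus> \<beta> \<otimes> (u \<otimes> w)"] avoiding[of "u \<otimes> w"] assms U_mult U_carrier \<alpha> \<beta>
  by auto

text \<open>The two kinds of lines in a derived spread are disjoint: \<open>height w f s u\<close>
  differs from \<open>s\<close> by an element outside \<open>Fix w\<close>.\<close>

lemma height_notin_coset:
  assumes "w \<in> U" "B \<in> cosets w" "u \<in> U" "f \<in> Fix w" "f \<noteq> \<zero>" "s \<in> B"
  shows "height w f s u \<notin> B"
proof
  assume "height w f s u \<in> B"
  then have "height w f s u \<ominus> s \<in> Fix w" using coset_diff assms by blast
  moreover have "height w f s u \<ominus> s = f \<otimes> (\<alpha> \<oplus> \<beta> \<otimes> (u \<otimes> w))"
  proof -
    have "s \<in> carrier K" using assms coset_subset by blast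
    moreover have "f \<otimes> (\<alpha> \<oplus> \<beta> \<otimes> (u \<otimes> w)) \<in> carrier K"
      using assms \<alpha> \<beta> U_carrier Fix_carrier by simp
    ultimately show ?thesis unfolding height_def by algebra
  qed
  ultimately show False using avoiding_mult assms by simp
qed

text \<open>If two lines of the second kind meet over \<open>u\<close>, then
  \<open>f \<ominus> f'\<close> times the avoiding factor is \<open>s' \<ominus> s\<close>, an
  element of \<open>Fix w\<close>; this forces \<open>f = f'\<close>.\<close>

lemma height_eq_imp:
  assumes "w \<in> U" "B \<in> cosets w" "u \<in> U" "f \<in> Fix w" "f' \<in> Fix w" "s \<in> B" "s' \<in> B"
    and eq: "height w f s u = height w f' s' u"
  shows "f = f'" "s = s'"
proof -
  define g where "g = \<alpha> \<oplus> \<beta> \<otimes> (u \<otimes> w)"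
  have c: "s \<in> carrier K" "s' \<in> carrier K" "f \<in> carrier K" "f' \<in> carrier K" "g \<in> carrier K"
    using assms coset_subset Fix_carrier U_carrier \<alpha> \<beta> by (auto simp: g_def)
  have eq': "s \<oplus> f \<otimes> g = s' \<oplus> f' \<otimes> g" using eq by (simp add: height_def g_def)
  \<comment> \<open>A ring identity whose last bracket vanishes by \<open>eq'\<close>.\<close>
  have "(f \<ominus> f') \<otimes> g = s' \<ominus> s \<oplus> ((s \<oplus> f \<otimes> g) \<ominus> (s' \<oplus> f' \<otimes> g))"
    using c by algebra
  then have "(f \<ominus> f') \<otimes> g = s' \<ominus> s"
    unfolding eq' using c by (simp add: a_minus_def r_neg)
  then have "(f \<ominus> f') \<otimes> g \<in> Fix w"
    using coset_diff[OF assms(1,2,7,6)] by simp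
  then have "f \<ominus> f' = \<zero>"
    using avoiding_mult[OF assms(1,3) Fix_diff[OF U_carrier[OF assms(1)] assms(4,5)]]
    by (auto simp: g_def)
  then show "f = f'" using c by simp
  then show "s = s'" using eq' c by simp
qed

lemma height_diff:
  assumes "w \<in> U" "u \<in> U" "u' \<in> U" "f \<in> Fix w" "s \<in> carrier K"
  shows "height w f s u \<ominus> height w f s u' = (w \<otimes> f) \<otimes> (\<beta> \<otimes> (u \<ominus> u'))"
proof -
  have "w \<in> carrier K" "u \<in> carrier K" "u' \<in> carrier K" "f \<in> carrier K"
    using assms U_carrier Fix_carrier by auto
  then show ?thesis using assms(5) \<alpha> \<beta>(1) unfolding height_def by algebra
qed

section \<open>Lines joining two points, by the types of the points\<close>

lemma coset_carrier: "\<lbrakk>B \<in> cosets w; x \<in> B\<rbrakk> \<Longrightarrow> x \<in> carrier K"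
  using coset_subset by blast

lemma finite_coset: "B \<in> cosets w \<Longrightarrow> finite B"
  using finite_subset[OF coset_subset finite_K] .

text \<open>This lemma and the next three invert the definition of \<open>blk\<close> for two
  collinear points.\<close>

lemma collinear_Inl_Inl:
  assumes "k \<in> nodes" "l \<in> labels k" "v \<noteq> v'" "Inl v \<in> blk k l" "Inl v' \<in> blk k l"
  shows "k = None"
  using assms(1)
proof (cases rule: nodesE)
  case (2 w B)
  then show ?thesis using assms by auto
qed

lemma collinear_Inl_Inr:
  assumes "k \<in> nodes" "l \<in> labels k" "Inl v \<in> blk k l" "Inr (u, z) \<in> blk k l"
  shows "\<exists>w B. k = Some (w, B) \<and> w \<in> U \<and> B \<in> cosets w \<and> u \<in> U \<and> v = u \<otimes> w \<and> z \<in> B"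
  using assms(1)
proof (cases rule: nodesE)
  case 1
  then show ?thesis using assms by auto
next
  case (2 w B)
  then show ?thesis using assms by auto
qed

lemma collinear_Inr_same:
  assumes "k \<in> nodes" "l \<in> labels k" "z \<noteq> z'" "Inr (u, z) \<in> blk k l" "Inr (u, z') \<in> blk k l"
  shows "\<exists>w B. k = Some (w, B) \<and> w \<in> U \<and> B \<in> cosets w \<and> z \<in> B \<and> z' \<in> B"
  using assms(1)
proof (cases rule: nodesE)
  case 1
  then show ?thesis using assms by auto
next
  case (2 w B)
  then show ?thesis using assms by auto
qed

lemma collinear_Inr_different:
  assumes "k \<in> nodes" "l \<in> labels k" "u \<noteq> u'" "Inr (u, z) \<in> blk k l" "Inr (u', z') \<in> blk k l"
  shows "k = None \<and> z = z' \<or> (\<exists>w B f s. k = Some (w, B) \<and> w \<in> U \<and> B \<in> cosets w \<and> f \<in> Fix w \<and>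
    f \<noteq> \<zero> \<and> s \<in> B \<and> u \<in> U \<and> u' \<in> U \<and> z = height w f s u \<and> z' = height w f s u')"
  using assms(1)
proof (cases rule: nodesE)
  case 1
  then show ?thesis using assms by auto
next
  case (2 w B)
  show ?thesis
  proof (cases l)
    case (Inl v)
    then show ?thesis using 2 assms by auto
  next
    case (Inr fs)
    obtain f s where "fs = (f, s)" by fastforce
    then have "f \<in> Fix w" "f \<noteq> \<zero>" "s \<in> B" "u \<in> U" "u' \<in> U" "z = height w f s u" "z' = height w f s u'"
      using 2 Inr assms by auto
    then show ?thesis using 2 by blast
  qed
qed

lemma node_eqI:
  assumes "t \<noteq> \<zero>" "w \<in> U" "w' \<in> U" "t \<in> Fix w" "t \<in> Fix w'"
    and "B \<in> cosets w" "B' \<in> cosets w'" "z \<in> B" "z \<in> B'"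
  shows "Some (w, B) = Some (w', B')"
  using Fix_unique[OF assms(4,5,1)] coset_unique[of w B B' z] assms U_carrier by auto

lemma diff_nonzero: "\<lbrakk>x \<noteq> y; x \<in> carrier K; y \<in> carrier K\<rbrakk> \<Longrightarrow> x \<ominus> y \<noteq> \<zero>"
  by simp

text \<open>Two points reveal their spread: a mixed pair gives \<open>w\<close> as a quotient of
  first coordinates, points over the same \<open>u\<close> give the direction of \<open>B\<close>,
  and points over different \<open>u\<close> give the slope of a line of the second kind.\<close>

lemma blk_inter:
  assumes k: "k \<in> nodes" "l \<in> labels k" "x \<in> blk k l" "y \<in> blk k l"
    and k': "k' \<in> nodes" "l' \<in> labels k'" "x \<in> blk k' l'" "y \<in> blk k' l'"
    and "x \<noteq> y"
  shows "k = k'"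
proof -
  have mixed: "k = k'"
    if m: "Inl v \<in> blk k l" "Inr (u, z) \<in> blk k l" "Inl v \<in> blk k' l'" "Inr (u, z) \<in> blk k' l'" for v u z
  proof -
    obtain w B where 1: "k = Some (w, B)" "w \<in> U" "B \<in> cosets w" "u \<in> U" "v = u \<otimes> w" "z \<in> B"
      using collinear_Inl_Inr[OF k(1,2) m(1,2)] by blast
    obtain w' B' where 2: "k' = Some (w', B')" "w' \<in> U" "B' \<in> cosets w'" "v = u \<otimes> w'" "z \<in> B'"
      using collinear_Inl_Inr[OF k'(1,2) m(3,4)] by blast
    have "w = w'" using 1 2 U_nonzero[OF 1(4)] U_carrier by (metis m_lcancel)
    then show ?thesis using 1 2 coset_unique by blast
  qed
  show ?thesis
  proof (cases x)
    case (Inl v)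
    show ?thesis
    proof (cases y)
      case (Inl v')
      then show ?thesis
        using \<open>x = Inl v\<close> collinear_Inl_Inl[OF k(1,2)] collinear_Inl_Inl[OF k'(1,2)] k k' \<open>x \<noteq> y\<close>
        by metis
    next
      case (Inr uz)
      then show ?thesis using \<open>x = Inl v\<close> mixed k k' by (metis surj_pair)
    qed
  next
    case x: (Inr uz)
    obtain u z where uz: "uz = (u, z)" by fastforce
    show ?thesis
    proof (cases y)
      case (Inl v)
      then show ?thesis using x mixed k k' uz by metis
    next
      case y: (Inr uz')
      obtain u' z' where uz': "uz' = (u', z')" by fastforce
      show ?thesis
      proof (cases "u = u'")
        case True
        then have "z \<noteq> z'" using x y uz uz' \<open>x \<noteq> y\<close> by auto
        obtain w B where 1: "k = Some (w, B)" "w \<in> U" "B \<in> cosets w" "z \<in> B" "z' \<in> B"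
          using collinear_Inr_same[OF k(1,2) \<open>z \<noteq> z'\<close>] k x y uz uz' True by metis
        obtain w' B' where 2: "k' = Some (w', B')" "w' \<in> U" "B' \<in> cosets w'" "z \<in> B'" "z' \<in> B'"
          using collinear_Inr_same[OF k'(1,2) \<open>z \<noteq> z'\<close>] k' x y uz uz' True by metis
        have "z \<ominus> z' \<noteq> \<zero>" using diff_nonzero[OF \<open>z \<noteq> z'\<close>] coset_subset 1 by blast
        then show ?thesis
          using node_eqI[of "z \<ominus> z'" w w' B B' z] coset_diff 1 2 by simp
      next
        case False
        let ?A = "\<lambda>k w B f s. k = Some (w, B) \<and> w \<in> U \<and> B \<in> cosets w \<and> f \<in> Fix w \<and>
          f \<noteq> \<zero> \<and> s \<in> B \<and> u \<in> U \<and> u' \<in> U \<and> z = height w f s u \<and> z' = height w f s u'"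
        have 1: "k = None \<and> z = z' \<or> (\<exists>w B f s. ?A k w B f s)"
          using collinear_Inr_different[OF k(1,2) False] k x y uz uz' by simp
        have 2: "k' = None \<and> z = z' \<or> (\<exists>w B f s. ?A k' w B f s)"
          using collinear_Inr_different[OF k'(1,2) False] k' x y uz uz' by simp
        \<comment> \<open>A line of the second kind has distinct heights over distinct
          \<open>u\<close>, which excludes the regular spread, where \<open>z = z'\<close>.\<close>
        have d: "z \<ominus> z' = (w \<otimes> f) \<otimes> (\<beta> \<otimes> (u \<ominus> u'))" "z \<noteq> z'"
          "\<beta> \<otimes> (u \<ominus> u') \<in> carrier K" "\<beta> \<otimes> (u \<ominus> u') \<noteq> \<zero>"
          if "?A k w B f s" for k w B f s
        proof -
          have c: "s \<in> carrier K" "w \<in> carrier K" "f \<in> carrier K" "u \<in> carrier K" "u' \<in> carrier K"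
            using that coset_subset U_carrier Fix_carrier by auto
          show eq: "z \<ominus> z' = (w \<otimes> f) \<otimes> (\<beta> \<otimes> (u \<ominus> u'))"
            using height_diff that c(1) by simp
          show "\<beta> \<otimes> (u \<ominus> u') \<in> carrier K" using c \<beta> by simp
          show ne: "\<beta> \<otimes> (u \<ominus> u') \<noteq> \<zero>" using c \<beta> False by (simp add: integral_iff)
          have "w \<otimes> f \<noteq> \<zero>" using that U_nonzero c by (simp add: integral_iff)
          then have "z \<ominus> z' \<noteq> \<zero>" unfolding eq using ne c \<beta> by (simp add: integral_iff)
          moreover have "z \<in> carrier K" using that height_closed c by blast
          ultimately show "z \<noteq> z'" by (auto simp: a_minus_def r_neg)
        qed
        show ?thesis
        proof (cases "k = None \<or> k' = None")
          case True
          then show ?thesis using 1 2 d(2) by blast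
        next
          case False
          obtain w B f s where A: "?A k w B f s" using 1 False by blast
          obtain w' B' f' s' where A': "?A k' w' B' f' s'" using 2 False by blast
          have c: "w \<otimes> f \<in> carrier K" "w' \<otimes> f' \<in> carrier K" "f \<in> carrier K" "f' \<in> carrier K"
            "s \<in> carrier K" "s' \<in> carrier K"
            using A A' U_carrier Fix_carrier coset_carrier by auto
          have "(w \<otimes> f) \<otimes> (\<beta> \<otimes> (u \<ominus> u')) = (w' \<otimes> f') \<otimes> (\<beta> \<otimes> (u \<ominus> u'))"
            using d(1)[OF A] d(1)[OF A'] by simp
          then have "w \<otimes> f = w' \<otimes> f'" using m_rcancel[OF d(4,3)[OF A] c(1,2)] by blast
          \<comment> \<open>The slope factor \<open>w \<otimes> f\<close> is \<open>f [^] q\<close>,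
            so it determines \<open>f\<close>, and \<open>f\<close> determines
            \<open>w\<close>.\<close>
          then have "f [^] q = f' [^] q" using Fix_pow[of f w] Fix_pow[of f' w'] A A' by metis
          then have ff: "f = f'" using pow_q_inj c by blast
          have "w = w'" using Fix_unique[of f w w'] A A' ff U_carrier by blast
          \<comment> \<open>Subtracting the common term leaves \<open>s\<close>, and
            \<open>B\<close> is the coset containing it.\<close>
          moreover have "s = s'"
          proof -
            have "f \<otimes> (\<alpha> \<oplus> \<beta> \<otimes> (u \<otimes> w)) \<in> carrier K"
              using A c \<alpha> \<beta> U_carrier by auto
            moreover have "height w f s u = height w f s' u" using A A' ff \<open>w = w'\<close> by simp
            ultimately show ?thesis using c by (simp add: height_def)
          qed
          ultimately show ?thesis using A A' coset_unique by blast
        qed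
      qed
    qed
  qed
qed

text \<open>Lines of the first kind are separated by \<open>u\<close>; the remaining cases are
  \<open>height_notin_coset\<close> and \<open>height_eq_imp\<close>.\<close>

lemma blk_disjoint:
  assumes "k \<in> nodes" "l \<in> labels k" "l' \<in> labels k" "x \<in> blk k l" "x \<in> blk k l'"
  shows "l = l'"
  using assms(1)
proof (cases rule: nodesE)
  case 1
  then show ?thesis using assms by auto
next
  case (2 w B)
  have inj: "u = u'" if "u \<in> U" "u' \<in> U" "u \<otimes> w = u' \<otimes> w" for u u'
    using that 2 U_carrier U_nonzero m_rcancel by metis
  have mixed: False if "Inl u \<in> labels k" "Inr (f, s) \<in> labels k" "x \<in> blk k (Inl u)" "x \<in> blk k (Inr (f, s))" for u f s
    using that 2 height_notin_coset[OF 2(2,3)] by auto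
  show ?thesis
  proof (cases l; cases l')
    fix u u' assume "l = Inl u" "l' = Inl u'"
    then show ?thesis using assms(2-5) 2 inj by auto
  next
    fix u fs assume "l = Inl u" "l' = Inr fs"
    then show ?thesis using assms(2-5) mixed by (metis surj_pair)
  next
    fix u fs assume "l = Inr fs" "l' = Inl u"
    then show ?thesis using assms(2-5) mixed by (metis surj_pair)
  next
    fix fs fs' assume *: "l = Inr fs" "l' = Inr fs'"
    obtain f s f' s' where fs: "fs = (f, s)" "fs' = (f', s')" by fastforce
    obtain u where "u \<in> U" "height w f s u = height w f' s' u"
      using assms(4,5) 2 * fs by auto
    then show ?thesis
      using height_eq_imp[OF 2(2,3), of u f f' s s'] assms(2,3) 2 * fs by auto
  qed
qed

sublocale res: plane_indexed_resolution q pts nodes labels blk "Sum_Type.Plus (carrier K) U" rows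
proof
  show "0 < q" using q_gt_1 by simp
  show "finite pts" "finite nodes" "finite (Sum_Type.Plus (carrier K) U)"
    using finite_U finite_K finite_cosets by (auto simp: pts_def nodes_def)
  show "card pts = (q + 1) * (q\<^sup>2 + 1)"
    using finite_U finite_K card_U card_K by (simp add: pts_def card_Plus card_cartesian_product)
  have "card (SIGMA w:U. cosets w) = (q + 1) * q"
    using finite_U finite_cosets card_cosets card_U by (simp add: card_SigmaI)
  then show "card nodes = q\<^sup>2 + q + 1"
    using finite_U finite_cosets by (simp add: nodes_def card_image power2_eq_square)
  show "card (Sum_Type.Plus (carrier K) U) = q\<^sup>2 + q + 1"
    using finite_U finite_K card_U card_K by (simp add: card_Plus)
next
  fix k assume k: "k \<in> nodes"
  then show "card (labels k) = q\<^sup>2 + 1"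
  proof (cases rule: nodesE)
    case 1
    then show ?thesis using finite_K card_K by (simp add: card_Plus card_cartesian_product)
  next
    case (2 w B)
    have "card (labels k) = (q + 1) + (q - 1) * q"
      using 2 finite_U finite_Fix finite_coset card_U card_coset card_Fix_nonzero
      by (simp add: card_Plus card_cartesian_product)
    also have "\<dots> = q\<^sup>2 + 1" using q_gt_1 by (simp add: power2_eq_square algebra_simps)
    finally show ?thesis .
  qed
  from k show "card (rows k) = q + 1"
  proof (cases rule: nodesE)
    case 1
    then show ?thesis using card_U by (simp add: card_image)
  next
    case (2 w B)
    have "Inr w \<notin> Inl ` B" by blast
    then show ?thesis using 2 finite_coset card_coset by (simp add: card_image)
  qed
  from k show "rows k \<subseteq> Sum_Type.Plus (carrier K) U"
    by (cases rule: nodesE) (use coset_subset in auto)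
  fix l assume l: "l \<in> labels k"
  from k show "blk k l \<subseteq> pts"
  proof (cases rule: nodesE)
    case 1
    then show ?thesis using l by (auto simp: pts_def)
  next
    case (2 w B)
    have "height w f s u \<in> carrier K" if "f \<in> Fix w" "s \<in> B" "u \<in> U" for f s u
      using height_closed 2 that coset_subset by blast
    then show ?thesis using l 2 coset_subset[OF 2(3)] U_mult by (auto simp: pts_def)
  qed
  from k show "card (blk k l) = q + 1"
  proof (cases rule: nodesE)
    case 1
    then show ?thesis using l card_U by (auto simp: card_image inj_on_def)
  next
    case (2 w B)
    have "card (insert (Inl v) ((\<lambda>z. Inr (u, z)) ` B)) = q + 1" for u v :: 'a
    proof -
      have "card ((\<lambda>z. Inr (u, z) :: 'a + 'a \<times> 'a) ` B) = q"
        using card_coset[OF 2(2,3)] by (simp add: card_image inj_on_def)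
      moreover have "Inl v \<notin> (\<lambda>z. Inr (u, z)) ` B" by blast
      ultimately show ?thesis using finite_coset[OF 2(3)] by simp
    qed
    then show ?thesis using l 2 card_U by (auto simp: card_image inj_on_def)
  qed
next
  fix k k' i s
  assume *: "k \<in> nodes" "k' \<in> nodes" "i \<noteq> s" "i \<in> rows k" "s \<in> rows k" "i \<in> rows k'" "s \<in> rows k'"
  \<comment> \<open>Two affine points determine the direction \<open>w\<close>, through their
    difference, and then the coset.\<close>
  have z: "Some (w, B) = Some (w', B')" if "w \<in> U" "w' \<in> U" "B \<in> cosets w" "B' \<in> cosets w'"
    "z \<in> B" "z' \<in> B" "z \<in> B'" "z' \<in> B'" "z \<noteq> z'" for w w' B B' z z'
  proof -
    have "z \<ominus> z' \<noteq> \<zero>" using diff_nonzero[OF \<open>z \<noteq> z'\<close>] coset_subset that by blast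
    then show ?thesis using node_eqI[of "z \<ominus> z'" w w' B B' z] coset_diff that by simp
  qed
  from *(1) show "k = k'"
  proof (cases rule: nodesE)
    case 1
    from *(2) show ?thesis by (cases rule: nodesE) (use 1 * in auto)
  next
    case k: (2 w B)
    from *(2) show ?thesis
    proof (cases rule: nodesE)
      case 1
      then show ?thesis using k * by auto
    next
      case k': (2 w' B')
      show ?thesis
        using * k k' z[of w w' B B'] coset_unique[of w B B'] by auto
    qed
  qed
next
  fix k k' l l' x y
  assume "k \<in> nodes" "k' \<in> nodes" "l \<in> labels k" "l' \<in> labels k'" "x \<noteq> y"
    "x \<in> blk k l" "y \<in> blk k l" "x \<in> blk k' l'" "y \<in> blk k' l'"
  then show "k = k'" using blk_inter by blast
qed (fact blk_disjoint)

end

section \<open>A Kirkman triple system for \<open>q = 2\<close>\<close>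

text \<open>The group of order 7 acts on 15 points with two regular orbits and one fixed point; the other
  parallel classes are the translates of the one listed here, found by computer search.\<close>

definition shift :: "nat \<Rightarrow> nat \<Rightarrow> nat" where
  "shift k x = (if x < 7 then (x + k) mod 7 else if x < 14 then 7 + (x + k) mod 7 else x)"

definition kirkman_block :: "nat \<Rightarrow> nat \<Rightarrow> nat list" where
  "kirkman_block k l = map (shift k)
     ([[0, 7, 14], [1, 5, 13], [2, 3, 12], [8, 9, 11], [4, 6, 10]] ! l)"

text \<open>\<open>{0, 1, 3}\<close> is a perfect difference set modulo 7, so its translates are the
  lines of the Fano plane.\<close>

definition fano_line :: "nat \<Rightarrow> nat list" where
  "fano_line k = map (\<lambda>x. (x + k) mod 7) [0, 1, 3]"

text \<open>Turns an intersection bound computed on lists into equality of common elements.\<close>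

lemma filter_mem_length_le_1:
  assumes "length (filter (\<lambda>x. x \<in> A) xs) \<le> 1" "x \<in> set xs" "y \<in> set xs" "x \<in> A" "y \<in> A"
  shows "x = y"
proof -
  let ?ys = "filter (\<lambda>x. x \<in> A) xs"
  have "card (set ?ys) \<le> 1" using card_length[of ?ys] assms(1) by linarith
  moreover have "x \<in> set ?ys" "y \<in> set ?ys" using assms by auto
  ultimately show ?thesis using card_le_Suc0_iff_eq[of "set ?ys"] by simp
qed

text \<open>Quantifiers range over explicit lists here and below so that evaluation decides the
  statements.\<close>

lemma kirkman_block_shape:
  "\<forall>k\<in>set [0..<7]. \<forall>l\<in>set [0..<5]. distinct (kirkman_block k l) \<and>
     length (kirkman_block k l) = 3 \<and> (\<forall>x\<in>set (kirkman_block k l). x < 15)"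
  by code_simp

lemma kirkman_blocks_disjoint:
  "\<forall>k\<in>set [0..<7]. \<forall>l\<in>set [0..<5]. \<forall>l'\<in>set [0..<5]. l \<noteq> l' \<longrightarrow>
     (\<forall>x\<in>set (kirkman_block k l). x \<notin> set (kirkman_block k l'))"
  by code_simp

lemma kirkman_blocks_inter:
  "\<forall>k\<in>set [0..<7]. \<forall>k'\<in>set [0..<7]. \<forall>l\<in>set [0..<5]. \<forall>l'\<in>set [0..<5]. k \<noteq> k' \<longrightarrow>
     length (filter (\<lambda>x. x \<in> set (kirkman_block k' l')) (kirkman_block k l)) \<le> 1"
  by code_simp

lemma fano_line_shape:
  "\<forall>k\<in>set [0..<7]. distinct (fano_line k) \<and> length (fano_line k) = 3 \<and> (\<forall>x\<in>set (fano_line k). x < 7)"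
  by code_simp

lemma fano_lines_inter:
  "\<forall>k\<in>set [0..<7]. \<forall>k'\<in>set [0..<7]. k \<noteq> k' \<longrightarrow>
     length (filter (\<lambda>x. x \<in> set (fano_line k')) (fano_line k)) \<le> 1"
  by code_simp

interpretation kirkman: plane_indexed_resolution 2 "{..<15}" "{..<7}" "\<lambda>_. {..<5}"
  "\<lambda>k l. set (kirkman_block k l)" "{..<7}" "\<lambda>k. set (fano_line k)"
proof
  fix k l :: nat assume kl: "k \<in> {..<7}" "l \<in> {..<5}"
  then show "set (kirkman_block k l) \<subseteq> {..<15}" "card (set (kirkman_block k l)) = 2 + 1"
    using kirkman_block_shape by (auto simp: distinct_card)
  fix l' x assume "l' \<in> {..<5::nat}" "x \<in> set (kirkman_block k l)" "x \<in> set (kirkman_block k l')"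
  then show "l = l'"
    using kl kirkman_blocks_disjoint[rule_format, of k l l' x] by auto
next
  fix k k' l l' x y :: nat
  assume *: "k \<in> {..<7}" "k' \<in> {..<7}" "l \<in> {..<5}" "l' \<in> {..<5}" "x \<noteq> y"
    "x \<in> set (kirkman_block k l)" "y \<in> set (kirkman_block k l)"
    "x \<in> set (kirkman_block k' l')" "y \<in> set (kirkman_block k' l')"
  show "k = k'"
  proof (rule ccontr)
    assume "k \<noteq> k'"
    then have "length (filter (\<lambda>x. x \<in> set (kirkman_block k' l')) (kirkman_block k l)) \<le> 1"
      using * kirkman_blocks_inter[rule_format, of k k' l l'] by simp
    then show False using filter_mem_length_le_1 * by metis
  qed
next
  fix k :: nat assume k: "k \<in> {..<7}"
  then show "set (fano_line k) \<subseteq> {..<7}" "card (set (fano_line k)) = 2 + 1"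
    using fano_line_shape by (auto simp: distinct_card)
next
  fix k k' i s :: nat
  assume *: "k \<in> {..<7}" "k' \<in> {..<7}" "i \<noteq> s"
    "i \<in> set (fano_line k)" "s \<in> set (fano_line k)"
    "i \<in> set (fano_line k')" "s \<in> set (fano_line k')"
  show "k = k'"
  proof (rule ccontr)
    assume "k \<noteq> k'"
    then have "length (filter (\<lambda>x. x \<in> set (fano_line k')) (fano_line k)) \<le> 1"
      using * fano_lines_inter[rule_format, of k k'] by simp
    then show False using filter_mem_length_le_1 * by metis
  qed
qed simp_all

section \<open>Arithmetic of the parameters and assembly of both cases\<close>

lemma parameters_eq:
  fixes q :: nat
  assumes "q > 1"
  shows "(q ^ 3 - 1) div (q - 1) = q\<^sup>2 + q + 1"
    and "(q ^ 4 - 1) div (q - 1) = (q + 1) * (q\<^sup>2 + 1)"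
    and "((q ^ 4 - 1) * (q ^ 3 - 1)) div ((q ^ 2 - 1) * (q - 1)) = (q\<^sup>2 + q + 1) * (q\<^sup>2 + 1)"
proof -
  \<comment> \<open>Writing \<open>q\<close> as a successor removes truncated subtraction from the
    factorizations.\<close>
  obtain m where q: "q = Suc m" and m: "m > 0" using assms by (metis Suc_lessE One_nat_def)
  have nz: "q - 1 \<noteq> 0" using assms by simp
  have 3: "q ^ 3 - 1 = (q\<^sup>2 + q + 1) * (q - 1)"
    by (simp add: q power3_eq_cube power2_eq_square algebra_simps)
  have 4: "q ^ 4 - 1 = (q\<^sup>2 + 1) * (q\<^sup>2 - 1)"
    by (simp add: q power4_eq_xxxx power2_eq_square algebra_simps)
  have 2: "q\<^sup>2 - 1 = (q + 1) * (q - 1)"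
    by (simp add: q power2_eq_square algebra_simps)
  show "(q ^ 3 - 1) div (q - 1) = q\<^sup>2 + q + 1"
    unfolding 3 using nz by (rule nonzero_mult_div_cancel_right)
  have "q ^ 4 - 1 = ((q + 1) * (q\<^sup>2 + 1)) * (q - 1)"
    by (simp only: 4 2 mult_ac)
  then show "(q ^ 4 - 1) div (q - 1) = (q + 1) * (q\<^sup>2 + 1)"
    using nz by (metis nonzero_mult_div_cancel_right)
  have "(q ^ 4 - 1) * (q ^ 3 - 1) = ((q\<^sup>2 + q + 1) * (q\<^sup>2 + 1)) * ((q\<^sup>2 - 1) * (q - 1))"
    by (simp only: 4 3 mult_ac)
  moreover have "(q\<^sup>2 - 1) * (q - 1) \<noteq> 0"
    unfolding 2 using nz by (metis add_is_0 mult_is_0 zero_neq_one)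
  ultimately show "((q ^ 4 - 1) * (q ^ 3 - 1)) div ((q ^ 2 - 1) * (q - 1)) = (q\<^sup>2 + q + 1) * (q\<^sup>2 + 1)"
    by (metis nonzero_mult_div_cancel_right)
qed

theorem theorem7:
  fixes q :: nat
  assumes "primepow q"
  shows "\<exists>(V :: nat set) R C.
    unordered_triple_array
      ((q ^ 3 - 1) div (q - 1))
      ((q ^ 4 - 1) div (q - 1))
      (((q ^ 4 - 1) * (q ^ 3 - 1)) div ((q ^ 2 - 1) * (q - 1)))
      V R C"
proof (cases "q = 2")
  case True
  then show ?thesis
    using kirkman.unordered_triple_array by (simp only: parameters_eq)
next
  case False
  have "q > 1" using primepow_gt_Suc_0[OF assms] by simp
  then have "q > 2" using False by simp
  obtain p n where p: "Factorial_Ring.prime p" and n: "n > 0" "q = p ^ n"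
    using assms by (auto simp: primepow_def)
  \<comment> \<open>The exponent \<open>n * 2\<close> gives order \<open>q^2\<close>; additivity of
    \<open>q\<close>-th powers holds because \<open>q\<close> is a power of the
    characteristic.\<close>
  obtain K :: "((int list \<times> nat) multiset \<Rightarrow> int) ring" where K: "field K" "finite (carrier K)"
    "card (carrier K) = p ^ (n * 2)" "[p] \<cdot>\<^bsub>K\<^esub> \<one>\<^bsub>K\<^esub> = \<zero>\<^bsub>K\<^esub>"
    using exists_finite_field[OF p, of "n * 2"] n by auto
  interpret field K by (rule K)
  interpret quadratic_finite_field K q
    using \<open>q > 1\<close> K n prime_power_char_pow_add[OF p K(4)]
    by unfold_locales (auto simp: power_mult)
  obtain \<alpha> \<beta> where "\<alpha> \<in> carrier K" "\<beta> \<in> carrier K" "\<beta> \<noteq> \<zero>\<^bsub>K\<^esub>"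
    "\<forall>u\<in>U. \<alpha> \<oplus>\<^bsub>K\<^esub> \<beta> \<otimes>\<^bsub>K\<^esub> u \<notin> Fix \<one>\<^bsub>K\<^esub>"
    \<comment> \<open>The two cases are \<open>\<ominus> \<one> \<noteq> \<one>\<close> and
      \<open>\<ominus> \<one> = \<one>\<close>.\<close>
    using exists_avoiding_pair_odd exists_avoiding_pair_even \<open>q > 2\<close> by metis
  then interpret avoiding_pair K q \<alpha> \<beta>
    by unfold_locales auto
  show ?thesis
    using res.unordered_triple_array by (simp only: parameters_eq[OF \<open>q > 1\<close>])
qed

end
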